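(* There exists a constant $c_0>0$ such that the following holds for all $t\in\mathbb{N}$ and all integers $n\ge c_0 t$. Let $A,B\subset S_n$ be cross $t$-intersecting families. Then: \begin{itemize} \item $|A||B|\le (n-t)!^2$. \item If $|A||B|\ge 0.75\,(n-t)!^2$, then there exist $i_1,\ldots,i_t$ and $j_1,\ldots,j_t$ such that $A,B\subset (S_n)_{i_1\to j_1,\ldots,i_t\to j_t}$. \item If $A=B$ and $|A|\ge 0.75\,(n-t)!$, then there exist $i_1,\ldots,i_t$ and $j_1,\ldots,j_t$ such that $A\subset (S_n)_{i_1\to j_1,\ldots,i_t\to j_t}$. \end{itemize}
   Context: $\mathbb{N}=\{1,2,3,\ldots\}$, $[n]=\{1,\ldots,n\}$, and $S_n$ is the set of all permutations of $[n]$. Families $A,B\subset S_n$ are cross $t$-intersecting if for every $\sigma\in A$ and $\tau\in B$ there exist $t$ distinct elements $i_1,\ldots,i_t\in[n]$ with $\sigma(i_\ell)=\tau(i_\ell)$ for all $1\le \ell\le t$. For distinct $i_1,\ldots,i_t\in[n]$ and distinct $j_1,\ldots,j_t\in[n]$, the $t$-umvirate is $(S_n)_{i_1\to j_1,\ldots,i_t\to j_t}=\{\sigma\in S_n:\ \sigma(i_\ell)=j_\ell \text{ for all } 1\le \ell\le t\}$. In the claim, $i_1,\ldots,i_t$ are distinct elements of $[n]$ and $j_1,\ldots,j_t$ are distinct elements of $[n]$. $(n-t)!^2$ means $((n-t)!)^2$. *)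

theory Defs
  imports Complex_Main "HOL-Combinatorics.Permutations"
begin

(* Permutations of {1..n} are functions on nat that are the identity outside {1..n};
   this makes the representation unique, so the cardinality of symm_group n is n!. *)
definition symm_group :: "nat \<Rightarrow> (nat \<Rightarrow> nat) set" where
  "symm_group n = {\<sigma>. \<sigma> permutes {1..n}}"

(* i enumerates t distinct elements of {1..n}; values of i outside {1..t} are irrelevant. *)
definition distinct_points :: "nat \<Rightarrow> nat \<Rightarrow> (nat \<Rightarrow> nat) \<Rightarrow> bool" where
  "distinct_points n t i \<longleftrightarrow> i ` {1..t} \<subseteq> {1..n} \<and> inj_on i {1..t}"

definition cross_intersecting ::
    "nat \<Rightarrow> nat \<Rightarrow> (nat \<Rightarrow> nat) set \<Rightarrow> (nat \<Rightarrow> nat) set \<Rightarrow> bool" where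
  "cross_intersecting n t A B \<longleftrightarrow>
     (\<forall>\<sigma>\<in>A. \<forall>\<tau>\<in>B. \<exists>i. distinct_points n t i \<and> (\<forall>l\<in>{1..t}. \<sigma> (i l) = \<tau> (i l)))"

definition umvirate :: "nat \<Rightarrow> nat \<Rightarrow> (nat \<Rightarrow> nat) \<Rightarrow> (nat \<Rightarrow> nat) \<Rightarrow> (nat \<Rightarrow> nat) set" where
  "umvirate n t i j = {\<sigma> \<in> symm_group n. \<forall>l\<in>{1..t}. \<sigma> (i l) = j l}"

end

theory Submission
  imports Defs "HOL-Real_Asymp.Real_Asymp"
begin

text \<open>
  Regard a permutation \<open>p\<close> as the set of its cells \<open>(i, p i)\<close>, and let \<open>a\<close> and \<open>b\<close> be the frequencies of a
  cell in \<open>A\<close> and \<open>B\<close>. If only the cells with \<open>b < \<rho>\<close> are counted, the mean over \<open>q \<in> B\<close> of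
  \<open>min |p \<inter> q| t\<close> is a \<open>2\<rho>\<close>-Lipschitz function of \<open>p\<close> with mean at most \<open>2t/3\<close> on the symmetric group.
  For \<open>\<rho>\<^sup>2\<close> of order \<open>t / (n log n)\<close> it is close to or above \<open>t\<close> only on a fraction \<open>n ^ (-6t)\<close> of all
  permutations, which is negligible inside \<open>A\<close>. So a constant fraction of the agreements lies on the
  at most \<open>n/\<rho>\<close> remaining cells, and some cell has \<open>a b \<ge> t \<rho> / (7n)\<close>.

  Such a cell captures almost all of both families: the part of \<open>A\<close> off the cell splits into
  \<open>n - 1\<close> pieces, each crossing the part of \<open>B\<close> on the cell inside a symmetric group of degree \<open>n - 1\<close>,
  and so contributes only a relative \<open>O(1/n)\<close>; the part where both are off the cell
  is controlled by \<open>a b\<close>. The relative losses along \<open>t\<close> such restrictions add up to a small constant,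
  so a \<open>t\<close>-umvirate captures nearly everything; a permutation outside of it would force a third of
  the umvirate to be missing from the other family.
\<close>

subsection \<open>Concentration for random permutations\<close>

text \<open>Averaged over a centred \<open>y\<close>, the linear term vanishes and only the Gaussian
  factor \<open>exp (y\<^sup>2)\<close> remains; this is the one-step estimate of the martingale
  argument below.\<close>

lemma exp_le_add_exp_square: "exp y \<le> y + exp (y\<^sup>2)" for y :: real
proof -
  have sq: "1 + y\<^sup>2 \<le> exp (y\<^sup>2)"
    by (rule exp_ge_add_one_self)
  consider "y \<ge> 1" | "0 \<le> y" "y \<le> 1" | "-1 \<le> y" "y \<le> 0" | "y \<le> -1"
    by linarith
  then show ?thesis
  proof cases
    case 1
    then have "y \<le> y\<^sup>2" by (simp add: power2_eq_square)
    then have "exp y \<le> exp (y\<^sup>2)" by (simp only: exp_le_cancel_iff)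
    with 1 show ?thesis by linarith
  next
    case 2
    then show ?thesis using exp_bound[of y] sq by linarith
  next
    case 3
    define z where "z = -y"
    have z: "0 \<le> z" "z \<le> 1" using 3 by (auto simp: z_def)
    have "1 \<le> (1 - z + z\<^sup>2) * (1 + z)"
      using z by (simp add: algebra_simps power2_eq_square)
    also have "\<dots> \<le> (1 - z + z\<^sup>2) * exp z"
      using z exp_ge_add_one_self[of z] by (intro mult_left_mono) auto
    finally have "exp (-z) \<le> 1 - z + z\<^sup>2"
      by (simp add: exp_minus divide_simps mult.commute)
    then have "exp y \<le> 1 + y + y\<^sup>2" by (simp add: z_def)
    then show ?thesis using sq by linarith
  next
    case 4
    then have "1 \<le> exp (y\<^sup>2) + y" 
    proof -
      have "0 \<le> y * (y + 1)" using 4 by (simp add: mult_nonpos_nonpos)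
      then have "0 \<le> y\<^sup>2 + y" by (simp add: algebra_simps power2_eq_square)
      then show ?thesis using sq by linarith
    qed
    moreover have "exp y \<le> 1" using 4 by simp
    ultimately show ?thesis by linarith
  qed
qed

text \<open>Exposing the value of one point at a time; each exposure changes the conditional mean
  by at most \<open>2 * d\<close>.\<close>
lemma permutations_exp_moment_le:
  fixes f :: "('a \<Rightarrow> 'a) \<Rightarrow> real"
  assumes "finite S"
    and "\<And>p a b. p permutes S \<Longrightarrow> a \<in> S \<Longrightarrow> b \<in> S \<Longrightarrow> \<bar>f (transpose a b \<circ> p) - f p\<bar> \<le> d"
  shows "(\<Sum>p | p permutes S. exp (l * (f p - (\<Sum>p | p permutes S. f p) / fact (card S))))
    \<le> fact (card S) * exp (4 * l\<^sup>2 * d\<^sup>2 * real (card S))"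
  using assms
proof (induction S arbitrary: f rule: finite_induct)
  case empty
  have "{p. p permutes ({}::'a set)} = {id}" by auto
  then show ?case by simp
next
  case (insert a S)
  let ?T = "insert a S" and ?n = "card S"
  \<comment> \<open>A permutation of \<open>S\<close> fixes \<open>a\<close>, so
    \<open>transpose a b \<circ> p\<close> runs over the permutations of \<open>?T\<close> sending
    \<open>a\<close> to \<open>b\<close>. Hence \<open>m b\<close> is the conditional mean of
    \<open>f\<close> given that value.\<close>
  define F where "F b p = f (transpose a b \<circ> p)" for b p
  define m where "m b = (\<Sum>p | p permutes S. F b p) / fact ?n" for b
  define M where "M = (\<Sum>p | p permutes ?T. f p) / fact (card ?T)"
  have cP: "card {p. p permutes S} = fact ?n"
    using insert.hyps by (simp add: card_permutations)
  have cT: "card ?T = Suc ?n" using insert.hyps by simp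
  have M: "M = (\<Sum>b\<in>?T. m b) / real (Suc ?n)"
    unfolding M_def m_def F_def sum_over_permutations_insert[OF insert.hyps] cT
    by (simp add: sum_divide_distrib field_simps)
  have IH: "(\<Sum>p | p permutes S. exp (l * (F b p - m b)))
      \<le> fact ?n * exp (4 * l\<^sup>2 * d\<^sup>2 * real ?n)" if b: "b \<in> ?T" for b
    unfolding m_def
  proof (rule insert.IH)
    fix p x y assume p: "p permutes S" and x: "x \<in> S" and y: "y \<in> S"
    let ?t = "transpose a b"
    \<comment> \<open>A swap conjugated by \<open>?t\<close> is again a swap, so \<open>F b\<close>
      inherits the Lipschitz constant \<open>d\<close>.\<close>
    have "?t \<circ> (transpose x y \<circ> p) = transpose (?t x) (?t y) \<circ> (?t \<circ> p)"
      by (auto simp: fun_eq_iff transpose_def)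
    moreover have "?t \<circ> p permutes ?T"
      using p b by (meson insertI1 permutes_compose permutes_imp_permutes_insert permutes_swap_id)
    moreover have "?t x \<in> ?T" "?t y \<in> ?T"
      using x y b by (auto simp: transpose_def)
    ultimately show "\<bar>F b (transpose x y \<circ> p) - F b p\<bar> \<le> d"
      unfolding F_def by (metis insert.prems)
  qed
  have ma: "\<bar>m b - m a\<bar> \<le> d" if b: "b \<in> ?T" for b
  proof -
    have "\<bar>(\<Sum>p | p permutes S. F b p) - (\<Sum>p | p permutes S. F a p)\<bar>
        \<le> (\<Sum>p | p permutes S. \<bar>F b p - F a p\<bar>)"
      by (simp add: sum_subtractf[symmetric])
    also have "\<dots> \<le> (\<Sum>p | p permutes S. d)"
    proof (intro sum_mono)
      fix p assume "p \<in> {p. p permutes S}"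
      then have "p permutes ?T" by (simp add: permutes_imp_permutes_insert)
      then show "\<bar>F b p - F a p\<bar> \<le> d"
        using b insert.prems[of p a b] by (simp only: F_def transpose_same id_o insertI1)
    qed
    also have "\<dots> = fact ?n * d" by (simp add: cP)
    finally show ?thesis
      by (simp add: m_def diff_divide_distrib[symmetric] field_simps)
  qed
  \<comment> \<open>\<open>M\<close> is the average of all \<open>m b\<close>, and each of them is
    within \<open>d\<close> of \<open>m a\<close>; so every \<open>m b\<close> is within
    \<open>2 * d\<close> of \<open>M\<close>.\<close>
  have Ma: "\<bar>M - m a\<bar> \<le> d"
  proof -
    have "M - m a = (\<Sum>b\<in>?T. m b - m a) / real (Suc ?n)"
      using insert.hyps by (simp add: M sum_subtractf field_simps)
    also have "\<bar>\<dots>\<bar> \<le> (\<Sum>b\<in>?T. \<bar>m b - m a\<bar>) / real (Suc ?n)"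
      by (simp add: divide_right_mono)
    also have "\<dots> \<le> (\<Sum>b\<in>?T. d) / real (Suc ?n)"
      by (intro divide_right_mono sum_mono ma) auto
    also have "\<dots> = d" using cT by simp
    finally show ?thesis .
  qed
  have step: "exp (l * (m b - M)) \<le> l * (m b - M) + exp (4 * l\<^sup>2 * d\<^sup>2)" if "b \<in> ?T" for b
  proof -
    have "\<bar>m b - M\<bar> \<le> 2 * d" using ma[OF that] Ma by linarith
    then have "(m b - M)\<^sup>2 \<le> (2 * d)\<^sup>2"
      using abs_le_square_iff[of "m b - M" "2 * d"] by linarith
    then have "l\<^sup>2 * (m b - M)\<^sup>2 \<le> l\<^sup>2 * (2 * d)\<^sup>2"
      by (rule mult_left_mono) simp
    then have "(l * (m b - M))\<^sup>2 \<le> 4 * l\<^sup>2 * d\<^sup>2"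
      by (simp add: power_mult_distrib)
    then show ?thesis
      using exp_le_add_exp_square[of "l * (m b - M)"] by (smt (verit) exp_le_cancel_iff)
  qed
  have "(\<Sum>p | p permutes ?T. exp (l * (f p - M)))
      = (\<Sum>b\<in>?T. \<Sum>p | p permutes S. exp (l * (F b p - M)))"
    unfolding sum_over_permutations_insert[OF insert.hyps] F_def ..
  also have "\<dots> = (\<Sum>b\<in>?T. exp (l * (m b - M)) * (\<Sum>p | p permutes S. exp (l * (F b p - m b))))"
    by (simp add: sum_distrib_left exp_add[symmetric] algebra_simps)
  also have "\<dots> \<le> (\<Sum>b\<in>?T. (l * (m b - M) + exp (4 * l\<^sup>2 * d\<^sup>2))
      * (fact ?n * exp (4 * l\<^sup>2 * d\<^sup>2 * real ?n)))"
    using step IH by (intro sum_mono mult_mono) (auto intro!: sum_nonneg order.trans[OF _ step])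
  also have "\<dots> = (\<Sum>b\<in>?T. l * (m b - M) + exp (4 * l\<^sup>2 * d\<^sup>2))
      * (fact ?n * exp (4 * l\<^sup>2 * d\<^sup>2 * real ?n))"
    by (simp only: sum_distrib_right)
  also have "(\<Sum>b\<in>?T. l * (m b - M) + exp (4 * l\<^sup>2 * d\<^sup>2)) = real (Suc ?n) * exp (4 * l\<^sup>2 * d\<^sup>2)"
  proof -
    have "(\<Sum>b\<in>?T. m b - M) = 0"
      using cT by (simp only: sum_subtractf sum_constant) (simp add: M)
    then show ?thesis
      using cT by (simp only: sum.distrib sum_distrib_left[symmetric]) simp
  qed
  also have "\<dots> * (fact ?n * exp (4 * l\<^sup>2 * d\<^sup>2 * real ?n))
      = fact (card ?T) * exp (4 * l\<^sup>2 * d\<^sup>2 * real (card ?T))"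
    by (simp add: cT exp_add[symmetric] algebra_simps)
  finally show ?case by (simp only: M_def)
qed

lemma permutations_concentration:
  fixes f :: "('a \<Rightarrow> 'a) \<Rightarrow> real"
  assumes S: "finite S" "S \<noteq> {}" and d: "d > 0" and s: "s \<ge> 0"
    and lip: "\<And>p a b. p permutes S \<Longrightarrow> a \<in> S \<Longrightarrow> b \<in> S \<Longrightarrow> \<bar>f (transpose a b \<circ> p) - f p\<bar> \<le> d"
  shows "real (card {p. p permutes S \<and> f p \<ge> (\<Sum>p | p permutes S. f p) / fact (card S) + s})
    \<le> fact (card S) * exp (- s\<^sup>2 / (16 * d\<^sup>2 * real (card S)))"
proof -
  let ?n = "card S" and ?M = "(\<Sum>p | p permutes S. f p) / fact (card S)"
  define E where "E = {p. p permutes S \<and> f p \<ge> ?M + s}"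
  \<comment> \<open>The minimiser of the Chernoff exponent
    \<open>4 * l\<^sup>2 * d\<^sup>2 * real ?n - l * s\<close>.\<close>
  define l where "l = s / (8 * d\<^sup>2 * real ?n)"
  have n: "real ?n > 0" using S by (simp add: card_gt_0_iff)
  have l: "l \<ge> 0" using s n by (simp add: l_def)
  have fin: "finite {p. p permutes S}" using S by (simp add: finite_permutations)
  have "real (card E) * exp (l * s) = (\<Sum>p\<in>E. exp (l * s))" by simp
  also have "\<dots> \<le> (\<Sum>p\<in>E. exp (l * (f p - ?M)))"
    using l by (intro sum_mono) (auto simp: E_def intro!: mult_left_mono)
  also have "\<dots> \<le> (\<Sum>p | p permutes S. exp (l * (f p - ?M)))"
    using fin by (intro sum_mono2) (auto simp: E_def)
  also have "\<dots> \<le> fact ?n * exp (4 * l\<^sup>2 * d\<^sup>2 * real ?n)"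
    using S lip by (intro permutations_exp_moment_le) auto
  finally have "real (card E) \<le> fact ?n * exp (4 * l\<^sup>2 * d\<^sup>2 * real ?n) / exp (l * s)"
    by (simp add: field_simps)
  also have "\<dots> = fact ?n * exp (4 * l\<^sup>2 * d\<^sup>2 * real ?n - l * s)"
    by (simp add: exp_diff)
  also have "4 * l\<^sup>2 * d\<^sup>2 * real ?n - l * s = - s\<^sup>2 / (16 * d\<^sup>2 * real ?n)"
    using n d by (simp add: l_def power2_eq_square field_simps)
  finally show ?thesis by (simp add: E_def)
qed

subsection \<open>Permutations with prescribed agreements\<close>

lemma permutes_agreeing_eq:
  assumes "K \<subseteq> S" "q permutes S"
  shows "{p. p permutes S \<and> (\<forall>i\<in>K. p i = q i)} = (\<circ>) q ` {r. r permutes S - K}"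
proof (intro equalityI subsetI)
  fix p assume p: "p \<in> {p. p permutes S \<and> (\<forall>i\<in>K. p i = q i)}"
  have "inv q \<circ> p permutes S - K"
  proof (rule permutes_superset)
    show "inv q \<circ> p permutes S"
      using p assms(2) by (simp add: permutes_compose permutes_inv)
  next
    fix x assume "x \<in> S - (S - K)"
    then show "(inv q \<circ> p) x = x"
      using p permutes_inverses[OF assms(2)] by auto
  qed
  moreover have "p = q \<circ> (inv q \<circ> p)"
    using permutes_inv_o(1)[OF assms(2)] by (simp add: o_assoc)
  ultimately show "p \<in> (\<circ>) q ` {r. r permutes S - K}" by blast
next
  fix p assume "p \<in> (\<circ>) q ` {r. r permutes S - K}"
  then obtain r where r: "r permutes S - K" and p: "p = q \<circ> r" by blast
  have "r permutes S" using r by (rule permutes_subset) auto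
  then show "p \<in> {p. p permutes S \<and> (\<forall>i\<in>K. p i = q i)}"
    using assms r by (auto simp: p permutes_compose permutes_not_in)
qed

lemma inj_comp_permutes: "q permutes S \<Longrightarrow> inj ((\<circ>) q)"
  using permutes_inj[of q S] by (auto simp: inj_def fun_eq_iff)

lemma card_permutes_agreeing:
  assumes "finite S" "K \<subseteq> S" "q permutes S"
  shows "card {p. p permutes S \<and> (\<forall>i\<in>K. p i = q i)} = fact (card S - card K)"
proof -
  have "card ((\<circ>) q ` {r. r permutes S - K}) = card {r. r permutes S - K}"
    using inj_comp_permutes[OF assms(3)] by (intro card_image) (rule inj_on_subset, auto)
  then show ?thesis
    unfolding permutes_agreeing_eq[OF assms(2,3)]
    using assms(1,2) by (simp add: card_permutations card_Diff_subset finite_subset)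
qed

text \<open>Inclusion-exclusion stopped after a negative term bounds the indicator of
  \<open>n = 0\<close> from below. From \<open>n\<close> to \<open>n + 1\<close> the left side
  changes by \<open>-1 + n - (n choose 2)\<close>, which is at most 0 for
  \<open>n \<ge> 1\<close>.\<close>

lemma bonferroni_truncated:
  "1 - real n + real (n choose 2) - real (n choose 3) \<le> (if n = 0 then 1 else 0)"
proof (cases n)
  case 0
  then show ?thesis by (simp add: binomial_eq_0)
next
  case (Suc m)
  have *: "real m \<le> 1 + real (m choose 2)" for m :: nat
    by (induction m) (auto simp: numeral_2_eq_2)
  have "1 - real (Suc m) + real (Suc m choose 2) - real (Suc m choose 3) \<le> 0"
  proof (induction m)
    case 0
    then show ?case by (simp add: numeral_2_eq_2 numeral_3_eq_3)
  next
    case (Suc m)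
    have e: "Suc (Suc m) choose 2 = Suc m + (Suc m choose 2)"
      "Suc (Suc m) choose 3 = (Suc m choose 2) + (Suc m choose 3)"
      using binomial_Suc_Suc[of "Suc m" 1] binomial_Suc_Suc[of "Suc m" 2] by (simp_all add: numeral_2_eq_2 numeral_3_eq_3)
    show ?case using Suc *[of "Suc m"] unfolding e of_nat_add by linarith
  qed
  then show ?thesis using Suc by simp
qed

definition agree :: "'a set \<Rightarrow> ('a \<Rightarrow> 'a) \<Rightarrow> ('a \<Rightarrow> 'a) \<Rightarrow> 'a set" where
  "agree S p q = {i \<in> S. p i = q i}"

text \<open>Double counting of pairs of a permutation \<open>p\<close> and a \<open>k\<close>-set on
  which it agrees with \<open>q\<close>: each of the \<open>k\<close>-sets admits
  \<open>fact (card S - k)\<close> permutations.\<close>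

lemma sum_choose_card_agree:
  assumes S: "finite S" and q: "q permutes S" and k: "k \<le> card S"
  shows "(\<Sum>p | p permutes S. real (card (agree S p q) choose k)) = fact (card S) / fact k"
proof -
  let ?P = "{p. p permutes S}" and ?n = "card S"
  have fP: "finite ?P" using S by (simp add: finite_permutations)
  have "(\<Sum>p\<in>?P. card (agree S p q) choose k)
      = (\<Sum>p\<in>?P. card {K. K \<subseteq> agree S p q \<and> card K = k})"
    using S by (intro sum.cong) (auto simp: n_subsets agree_def)
  also have "\<dots> = (\<Sum>p\<in>?P. card {K \<in> {K. K \<subseteq> S \<and> card K = k}. \<forall>i\<in>K. p i = q i})"
    by (intro sum.cong arg_cong[where f = card]) (auto simp: agree_def)
  also have "\<dots> = (\<Sum>K | K \<subseteq> S \<and> card K = k. card {p \<in> ?P. \<forall>i\<in>K. p i = q i})"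
    using S fP by (intro sum_multicount_gen) auto
  also have "\<dots> = (\<Sum>K | K \<subseteq> S \<and> card K = k. fact (?n - k))"
    using S q by (intro sum.cong) (auto simp: card_permutes_agreeing)
  also have "\<dots> = (?n choose k) * fact (?n - k)"
    using S by (simp add: n_subsets)
  finally have "fact k * (\<Sum>p\<in>?P. card (agree S p q) choose k) = fact ?n"
    using binomial_fact_lemma[OF k] by (simp add: mult_ac)
  then have "real (fact k * (\<Sum>p\<in>?P. card (agree S p q) choose k)) = real (fact ?n)"
    by (simp only:)
  then have "fact k * real (\<Sum>p\<in>?P. card (agree S p q) choose k) = fact ?n"
    by (simp only: of_nat_mult of_nat_fact)
  then show ?thesis by (simp add: field_simps)
qed

text \<open>The binomial moments of the number of agreements are 1, 1, 1/2, 1/6 up to order 3, and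
  the truncated alternating sum is \<open>1 - 1 + 1 / 2 - 1 / 6 = 1 / 3\<close>.\<close>

lemma card_permutes_disagreeing_ge:
  assumes S: "finite S" and q: "q permutes S" and n: "card S \<ge> 3"
  shows "fact (card S) \<le> 3 * real (card {p. p permutes S \<and> agree S p q = {}})"
proof -
  let ?P = "{p. p permutes S}" and ?n = "card S"
  let ?X = "\<lambda>p. card (agree S p q)"
  have fP: "finite ?P" using S by (simp add: finite_permutations)
  have fa: "finite (agree S p q)" for p using S by (simp add: agree_def)
  have "(\<Sum>p\<in>?P. 1 - real (?X p) + real (?X p choose 2) - real (?X p choose 3))
      \<le> (\<Sum>p\<in>?P. if agree S p q = {} then 1 else 0)"
  proof (intro sum_mono)
    fix p
    have "?X p = 0 \<longleftrightarrow> agree S p q = {}" using fa by simp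
    then show "1 - real (?X p) + real (?X p choose 2) - real (?X p choose 3)
        \<le> (if agree S p q = {} then 1 else 0)"
      using bonferroni_truncated[of "?X p"] by presburger
  qed
  also have "\<dots> = real (card {p \<in> ?P. agree S p q = {}})"
    using fP by (simp add: sum.If_cases Int_def)
  finally have "(\<Sum>p\<in>?P. 1 - real (?X p) + real (?X p choose 2) - real (?X p choose 3))
      \<le> real (card {p. p permutes S \<and> agree S p q = {}})" by simp
  moreover have "(\<Sum>p\<in>?P. 1 - real (?X p) + real (?X p choose 2) - real (?X p choose 3))
      = fact ?n - fact ?n + fact ?n / 2 - fact ?n / 6"
    using sum_choose_card_agree[OF S q, of 0] sum_choose_card_agree[OF S q, of 1]
      sum_choose_card_agree[OF S q, of 2] sum_choose_card_agree[OF S q, of 3] n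
    by (simp add: sum.distrib sum_subtractf card_permutations[OF refl S] fact_numeral)
  ultimately show ?thesis by simp
qed

text \<open>The first-return map of \<open>q\<close> to \<open>T\<close>. Points of \<open>K\<close>
  are bypassed one at a time: composing with \<open>transpose a (q a)\<close> fixes \<open>a\<close>
  and sends its preimage straight to \<open>q a\<close>, leaving the other values unchanged.\<close>

lemma permutes_first_return:
  assumes "finite K" "T \<inter> K = {}" "q permutes T \<union> K"
  shows "\<exists>h. h permutes T \<and> (\<forall>i\<in>T. q i \<in> T \<longrightarrow> h i = q i)"
  using assms
proof (induction K arbitrary: q rule: finite_induct)
  case empty
  then show ?case by auto
next
  case (insert a K)
  define g where "g = transpose a (q a) \<circ> q"
  have "g permutes T \<union> K"
    unfolding g_def using insert.prems by (intro permutes_insert_lemma) simp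
  then obtain h where h: "h permutes T" "\<forall>i\<in>T. g i \<in> T \<longrightarrow> h i = g i"
    using insert.IH insert.prems by blast
  have "h i = q i" if i: "i \<in> T" "q i \<in> T" for i
  proof -
    have "q i \<noteq> a" "q i \<noteq> q a"
      using i insert.prems permutes_inj[OF insert.prems(2)] by (auto dest: injD)
    then have "g i = q i" by (simp add: g_def)
    then show ?thesis using h i by simp
  qed
  with h(1) show ?case by blast
qed

text \<open>Translation by \<open>inv q\<close> turns the umvirate into the permutations of
  \<open>S - I\<close>, and \<open>r\<close> into \<open>inv q \<circ> r\<close>, which may leave
  \<open>S - I\<close>. Its values inside \<open>S - I\<close> are completed to a permutation
  \<open>h\<close>; those outside can never be met. At least a third of the permutations of
  \<open>S - I\<close> avoid \<open>h\<close>.\<close>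

lemma card_umvirate_agreeing_le:
  assumes S: "finite S" and q: "q permutes S" and r: "r permutes S" and I: "I \<subseteq> S"
    and n: "card S - card I \<ge> 3"
  shows "3 * real (card {p. p permutes S \<and> (\<forall>i\<in>I. p i = q i) \<and> (\<exists>i\<in>S - I. p i = r i)})
    \<le> 2 * fact (card S - card I)"
proof -
  let ?T = "S - I"
  let ?A = "{p. p permutes ?T}" and ?D = "\<lambda>h. {p. p permutes ?T \<and> agree ?T p h = {}}"
  have cT: "card ?T = card S - card I"
    using S I by (simp add: card_Diff_subset finite_subset)
  have fT: "finite ?T" using S by simp
  have "inv q \<circ> r permutes ?T \<union> I"
    using q r I by (simp add: permutes_compose permutes_inv Un_absorb2)
  then obtain h where h: "h permutes ?T" "\<forall>i\<in>?T. (inv q \<circ> r) i \<in> ?T \<longrightarrow> h i = (inv q \<circ> r) i"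
    using permutes_first_return[of I ?T] S I finite_subset by blast
  have "{p. p permutes S \<and> (\<forall>i\<in>I. p i = q i) \<and> (\<exists>i\<in>?T. p i = r i)}
      \<subseteq> (\<circ>) q ` (?A - ?D h)"
  proof
    fix p assume p: "p \<in> {p. p permutes S \<and> (\<forall>i\<in>I. p i = q i) \<and> (\<exists>i\<in>?T. p i = r i)}"
    then have "p \<in> (\<circ>) q ` ?A"
      using permutes_agreeing_eq[OF I q] by blast
    then obtain s where s: "s permutes ?T" "p = q \<circ> s" by blast
    obtain i where i: "i \<in> ?T" "p i = r i" using p by blast
    have "s i = (inv q \<circ> r) i"
      using s(2) i(2) permutes_inverses[OF q] by (metis comp_apply)
    moreover have "s i \<in> ?T" using permutes_in_image[OF s(1)] i(1) by blast
    ultimately have "i \<in> agree ?T s h" using h i(1) by (auto simp: agree_def)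
    then show "p \<in> (\<circ>) q ` (?A - ?D h)" using s by blast
  qed
  then have "card {p. p permutes S \<and> (\<forall>i\<in>I. p i = q i) \<and> (\<exists>i\<in>?T. p i = r i)}
      \<le> card (?A - ?D h)"
    using fT by (intro surj_card_le) (auto simp: finite_permutations)
  also have "card (?A - ?D h) = card ?A - card (?D h)"
    using finite_permutations[OF fT] by (intro card_Diff_subset) (auto intro: finite_subset)
  finally have "real (card {p. p permutes S \<and> (\<forall>i\<in>I. p i = q i) \<and> (\<exists>i\<in>?T. p i = r i)})
      \<le> real (card ?A - card (?D h))" by simp
  also have "\<dots> = fact (card ?T) - real (card (?D h))"
    using card_mono[OF finite_permutations[OF fT], of "?D h"] fT
    by (subst of_nat_diff) (auto simp: card_permutations)
  finally show ?thesis
    using card_permutes_disagreeing_ge[OF fT h(1)] n unfolding cT by simp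
qed

subsection \<open>Heavy cells\<close>

text \<open>The ground set is arbitrary because every restriction to a cell deletes a point from
  it.\<close>

definition crossing :: "'a set \<Rightarrow> nat \<Rightarrow> ('a \<Rightarrow> 'a) set \<Rightarrow> ('a \<Rightarrow> 'a) set \<Rightarrow> bool" where
  "crossing S t A B \<longleftrightarrow> A \<subseteq> {p. p permutes S} \<and> B \<subseteq> {p. p permutes S} \<and>
     (\<forall>p\<in>A. \<forall>q\<in>B. t \<le> card (agree S p q))"

lemma agree_commute: "agree S p q = agree S q p"
  by (auto simp: agree_def)

lemma crossing_sym: "crossing S t A B \<Longrightarrow> crossing S t B A"
  unfolding crossing_def by (metis agree_commute)

lemma crossing_finite:
  assumes "finite S" "crossing S t A B"
  shows "finite A" "finite B"
  using assms finite_permutations[of S] by (auto simp: crossing_def intro: finite_subset)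

lemma crossing_le_card:
  assumes "finite S" "crossing S t A B" "A \<noteq> {}" "B \<noteq> {}"
  shows "t \<le> card S"
proof -
  obtain p q where "p \<in> A" "q \<in> B" using assms by blast
  then have "t \<le> card (agree S p q)" using assms(2) by (simp add: crossing_def)
  also have "\<dots> \<le> card S" using assms(1) by (intro card_mono) (auto simp: agree_def)
  finally show ?thesis .
qed

text \<open>Union bound over the \<open>t\<close>-sets on which a member of \<open>A\<close> agrees
  with one fixed member of \<open>B\<close>. It starts the induction far outside the range of the
  theorem.\<close>

lemma crossing_card_le:
  assumes S: "finite S" and c: "crossing S t A B" and B: "B \<noteq> {}"
  shows "card A \<le> 2 ^ card S * fact (card S - t)"
proof -
  obtain q where q: "q \<in> B" "q permutes S" using B c by (auto simp: crossing_def)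
  let ?I = "{I. I \<subseteq> S \<and> card I = t}"
  have fI: "finite ?I" using S by simp
  have "A \<subseteq> (\<Union>I\<in>?I. {p. p permutes S \<and> (\<forall>i\<in>I. p i = q i)})"
  proof
    fix p assume p: "p \<in> A"
    then have "t \<le> card (agree S p q)" using c q by (auto simp: crossing_def)
    then obtain I where I: "I \<subseteq> agree S p q" "card I = t"
      by (meson obtain_subset_with_card_n)
    then have "I \<in> ?I" "\<forall>i\<in>I. p i = q i" by (auto simp: agree_def)
    moreover have "p permutes S" using p c by (auto simp: crossing_def)
    ultimately show "p \<in> (\<Union>I\<in>?I. {p. p permutes S \<and> (\<forall>i\<in>I. p i = q i)})" by blast
  qed
  then have "card A \<le> card (\<Union>I\<in>?I. {p. p permutes S \<and> (\<forall>i\<in>I. p i = q i)})"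
    using fI finite_permutations[OF S] by (intro card_mono) auto
  also have "\<dots> \<le> (\<Sum>I\<in>?I. card {p. p permutes S \<and> (\<forall>i\<in>I. p i = q i)})"
    using fI by (rule card_UN_le)
  also have "\<dots> = (\<Sum>I\<in>?I. fact (card S - t))"
    using S q by (intro sum.cong) (auto simp: card_permutes_agreeing)
  also have "\<dots> = (card S choose t) * fact (card S - t)"
    using S by (simp add: n_subsets)
  also have "\<dots> \<le> 2 ^ card S * fact (card S - t)"
    by (simp add: binomial_le_pow2)
  finally show ?thesis .
qed

definition cyl :: "('a \<Rightarrow> 'a) set \<Rightarrow> 'a \<Rightarrow> 'a \<Rightarrow> ('a \<Rightarrow> 'a) set" where
  "cyl A i j = {p \<in> A. p i = j}"

text \<open>The root is the threshold \<open>\<rho>\<close>; with \<open>13824 = 6 * 2304\<close> the exceptional fraction in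
  \<open>card_g_large_le\<close> below becomes exactly \<open>n ^ (-6t)\<close>.\<close>
definition eta :: "nat \<Rightarrow> nat \<Rightarrow> real" where
  "eta n t = real t * sqrt (real t / (13824 * real n * ln (real n))) / (7 * real n)"

lemma sum_card_cyl:
  assumes S: "finite S" and A: "finite A" "A \<subseteq> {p. p permutes S}" and i: "i \<in> S"
  shows "(\<Sum>j\<in>S. card (cyl A i j)) = card A"
proof -
  have "A = (\<Union>j\<in>S. cyl A i j)"
    using A(2) i permutes_in_image by (fastforce simp: cyl_def)
  then have "card A = card (\<Union>j\<in>S. cyl A i j)" by simp
  also have "\<dots> = (\<Sum>j\<in>S. card (cyl A i j))"
    using S A(1) by (intro card_UN_disjoint) (auto simp: cyl_def)
  finally show ?thesis by simp
qed

text \<open>Both sides count triples of \<open>p\<close>, \<open>q\<close> and a cell of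
  \<open>W\<close> lying on both.\<close>

lemma sum_card_agree_on:
  assumes S: "finite S" and fin: "finite A" "finite B"
    and sub: "A \<subseteq> {p. p permutes S}" and W: "W \<subseteq> S \<times> S"
  shows "(\<Sum>p\<in>A. \<Sum>q\<in>B. real (card {i \<in> S. p i = q i \<and> (i, p i) \<in> W}))
    = (\<Sum>(i, j)\<in>W. real (card (cyl A i j)) * real (card (cyl B i j)))"
proof -
  have fW: "finite W" using W S finite_subset by blast
  have 1: "real (card {i \<in> S. p i = q i \<and> (i, p i) \<in> W})
      = (\<Sum>w\<in>W. of_bool (p (fst w) = snd w) * of_bool (q (fst w) = snd w))" for p q
  proof -
    have "bij_betw (\<lambda>i. (i, p i)) {i \<in> S. p i = q i \<and> (i, p i) \<in> W}
        {w \<in> W. p (fst w) = snd w \<and> q (fst w) = snd w}"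
      using W by (intro bij_betwI[where g = fst]) auto
    then have "card {i \<in> S. p i = q i \<and> (i, p i) \<in> W}
        = card {w \<in> W. p (fst w) = snd w \<and> q (fst w) = snd w}"
      by (rule bij_betw_same_card)
    also have "real \<dots> = (\<Sum>w\<in>W. of_bool (p (fst w) = snd w \<and> q (fst w) = snd w))"
      using fW by (simp add: of_bool_def sum.If_cases Int_def)
    finally show ?thesis by (simp add: of_bool_conj)
  qed
  have 2: "(\<Sum>p\<in>A. of_bool (p i = j)) = real (card (cyl A i j))" if "finite A" for A :: "('a \<Rightarrow> 'a) set" and i j
    using that by (simp add: cyl_def of_bool_def sum.If_cases Int_def)
  have "(\<Sum>p\<in>A. \<Sum>q\<in>B. real (card {i \<in> S. p i = q i \<and> (i, p i) \<in> W}))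
      = (\<Sum>w\<in>W. \<Sum>p\<in>A. \<Sum>q\<in>B. of_bool (p (fst w) = snd w) * of_bool (q (fst w) = snd w))"
    unfolding 1 by (subst sum.swap[of _ W], subst (2) sum.swap) (rule refl)
  also have "\<dots> = (\<Sum>w\<in>W. real (card (cyl A (fst w) (snd w))) * real (card (cyl B (fst w) (snd w))))"
    unfolding sum_product[symmetric] 2[OF fin(1)] 2[OF fin(2)] ..
  finally show ?thesis by (simp add: case_prod_beta)
qed

section \<open>Agreements on light cells\<close>

locale light_agreement =
  fixes S :: "'a set" and B :: "('a \<Rightarrow> 'a) set" and t :: nat and \<rho> :: real
  assumes S: "finite S" and B: "B \<subseteq> {p. p permutes S}" "B \<noteq> {}" and \<rho>: "\<rho> > 0"
begin

definition light :: "'a \<Rightarrow> 'a \<Rightarrow> bool" where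
  "light i j \<longleftrightarrow> real (card (cyl B i j)) < \<rho> * real (card B)"

definition X :: "('a \<Rightarrow> 'a) \<Rightarrow> ('a \<Rightarrow> 'a) \<Rightarrow> nat" where
  "X p q = card {i \<in> S. p i = q i \<and> light i (p i)}"

text \<open>The cap at \<open>t\<close> makes the mean at most \<open>t\<close> times the
  probability of any agreement, hence at most \<open>2 / 3 * t\<close>; the uncapped mean could be
  near 1, too large when \<open>t = 1\<close>. It also limits what exceptional permutations
  contribute.\<close>

definition g :: "('a \<Rightarrow> 'a) \<Rightarrow> real" where
  "g p = (\<Sum>q\<in>B. min (real (X p q)) (real t)) / real (card B)"

lemma finite_B: "finite B"
  using B(1) finite_permutations[OF S] finite_subset by blast

lemma card_B_pos: "real (card B) > 0"
  using finite_B B(2) by (simp add: card_gt_0_iff)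

text \<open>At a point \<open>w\<close> a light cell of \<open>p\<close> lies on at most
  \<open>\<rho> * card B\<close> members of \<open>B\<close>. Passing from \<open>p\<close> to
  \<open>p'\<close> loses an agreement at \<open>u\<close> or \<open>v\<close> only with those
  members, and at most one per point.\<close>

lemma g_le_two_points:
  assumes eq: "\<And>i. i \<in> S \<Longrightarrow> i \<noteq> u \<Longrightarrow> i \<noteq> v \<Longrightarrow> p i = p' i"
  shows "g p \<le> g p' + 2 * \<rho>"
proof -
  define h where "h w = {q \<in> B. q w = p w \<and> light w (p w)}" for w
  have hB: "finite (h w)" for w using finite_B by (simp add: h_def)
  have h: "real (card (h w)) \<le> \<rho> * real (card B)" for w
  proof (cases "light w (p w)")
    case True
    then have "h w = cyl B w (p w)" by (auto simp: h_def cyl_def)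
    then show ?thesis using True by (simp add: light_def)
  next
    case False
    then show ?thesis using \<rho> by (simp add: h_def)
  qed
  have X: "min (real (X p q)) (real t)
      \<le> min (real (X p' q)) (real t) + of_bool (q \<in> h u) + of_bool (q \<in> h v)" if q: "q \<in> B" for q
  proof -
    have "{i \<in> S. p i = q i \<and> light i (p i)} \<subseteq> {i \<in> S. p' i = q i \<and> light i (p' i)}
        \<union> ((if q \<in> h u then {u} else {}) \<union> (if q \<in> h v then {v} else {}))" (is "?L \<subseteq> ?M \<union> (?U \<union> ?V)")
    proof
      fix x assume x: "x \<in> ?L"
      show "x \<in> ?M \<union> (?U \<union> ?V)"
      proof (cases "x = u \<or> x = v")
        case True
        then show ?thesis using x q by (auto simp: h_def)
      next
        case False
        then have "p x = p' x" using eq x by blast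
        then have "x \<in> ?M" using x by (metis (mono_tags, lifting) mem_Collect_eq)
        then show ?thesis by blast
      qed
    qed
    then have "card ?L \<le> card (?M \<union> (?U \<union> ?V))"
      using S by (intro card_mono) auto
    also have "\<dots> \<le> card ?M + (card ?U + card ?V)"
      by (meson add_left_mono card_Un_le le_trans)
    finally have "X p q \<le> X p' q + of_bool (q \<in> h u) + of_bool (q \<in> h v)"
      by (auto simp: X_def split: if_splits)
    then have "real (X p q) \<le> real (X p' q + of_bool (q \<in> h u) + of_bool (q \<in> h v))"
      by (simp only: of_nat_le_iff)
    then show ?thesis by (auto simp: min_def)
  qed
  have "(\<Sum>q\<in>B. min (real (X p q)) (real t))
      \<le> (\<Sum>q\<in>B. min (real (X p' q)) (real t) + of_bool (q \<in> h u) + of_bool (q \<in> h v))"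
    by (intro sum_mono X)
  also have "\<dots> = (\<Sum>q\<in>B. min (real (X p' q)) (real t)) + real (card (h u)) + real (card (h v))"
    using finite_B by (simp add: sum.distrib of_bool_def sum.If_cases Int_def h_def)
  also have "\<dots> \<le> (\<Sum>q\<in>B. min (real (X p' q)) (real t)) + 2 * \<rho> * real (card B)"
    using h[of u] h[of v] by linarith
  finally show ?thesis
    using card_B_pos by (simp add: g_def field_simps)
qed

lemma g_lipschitz:
  assumes p: "p permutes S" and ab: "a \<in> S" "b \<in> S"
  shows "\<bar>g (transpose a b \<circ> p) - g p\<bar> \<le> 2 * \<rho>"
proof -
  have eq: "(transpose a b \<circ> p) i = p i" if "i \<noteq> inv p a" "i \<noteq> inv p b" for i
  proof -
    have "p i \<noteq> a" "p i \<noteq> b" using that permutes_inv_eq[OF p] by metis+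
    then show ?thesis by simp
  qed
  show ?thesis
    using g_le_two_points[of "inv p a" "inv p b" p "transpose a b \<circ> p"]
      g_le_two_points[of "inv p a" "inv p b" "transpose a b \<circ> p" p] eq by fastforce
qed

lemma g_mean_le:
  assumes n: "card S \<ge> 3"
  shows "(\<Sum>p | p permutes S. g p) / fact (card S) \<le> 2 / 3 * real t"
proof -
  let ?P = "{p. p permutes S}"
  have fP: "finite ?P" using S by (simp add: finite_permutations)
  have 1: "(\<Sum>p\<in>?P. min (real (X p q)) (real t)) \<le> 2 / 3 * real t * fact (card S)" if q: "q \<in> B" for q
  proof -
    have "min (real (X p q)) (real t) \<le> (if agree S p q = {} then 0 else real t)" for p
    proof (cases "agree S p q = {}")
      case True
      then have "{i \<in> S. p i = q i \<and> light i (p i)} = {}" by (auto simp: agree_def)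
      then have "X p q = 0" unfolding X_def by (simp only: card.empty)
      then show ?thesis by simp
    qed simp
    then have "(\<Sum>p\<in>?P. min (real (X p q)) (real t)) \<le> (\<Sum>p\<in>?P. if agree S p q = {} then 0 else real t)"
      by (intro sum_mono) auto
    also have "\<dots> = (\<Sum>p\<in>?P. real t - real t * (if agree S p q = {} then 1 else 0))"
      by (intro sum.cong) auto
    also have "\<dots> = real t * (fact (card S) - real (card {p. p permutes S \<and> agree S p q = {}}))"
      using fP by (simp add: sum_subtractf sum_distrib_left[symmetric] sum.If_cases Int_def card_permutations[OF refl S] algebra_simps)
    also have "\<dots> \<le> real t * (2 / 3 * fact (card S))"
      using card_permutes_disagreeing_ge[OF S _ n, of q] B q by (intro mult_left_mono) auto
    finally show ?thesis by simp
  qed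
  have "(\<Sum>p\<in>?P. g p) = (\<Sum>q\<in>B. \<Sum>p\<in>?P. min (real (X p q)) (real t)) / real (card B)"
    unfolding g_def sum_divide_distrib[symmetric] by (subst sum.swap) (rule refl)
  also have "\<dots> \<le> (\<Sum>q\<in>B. 2 / 3 * real t * fact (card S)) / real (card B)"
    by (intro divide_right_mono sum_mono 1) auto
  also have "\<dots> = 2 / 3 * real t * fact (card S)" using card_B_pos by simp
  finally show ?thesis by (simp add: field_simps)
qed

text \<open>Concentration with deviation \<open>t / 6\<close>, the gap between \<open>2 / 3\<close>
  and \<open>5 / 6\<close>, and Lipschitz constant \<open>2 * \<rho>\<close>;
  \<open>2304 = 36 * 16 * 4\<close>.\<close>

lemma card_g_large_le:
  assumes n: "card S \<ge> 3"
  shows "real (card {p. p permutes S \<and> g p \<ge> 5 / 6 * real t})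
    \<le> fact (card S) * exp (- (real t)\<^sup>2 / (2304 * \<rho>\<^sup>2 * real (card S)))"
proof -
  let ?M = "(\<Sum>p | p permutes S. g p) / fact (card S)"
  have "real (card {p. p permutes S \<and> g p \<ge> 5 / 6 * real t})
      \<le> real (card {p. p permutes S \<and> g p \<ge> ?M + real t / 6})"
    using finite_permutations[OF S] g_mean_le[OF n]
    by (intro of_nat_mono card_mono) auto
  also have "\<dots> \<le> fact (card S) * exp (- (real t / 6)\<^sup>2 / (16 * (2 * \<rho>)\<^sup>2 * real (card S)))"
    using S n \<rho> g_lipschitz by (intro permutations_concentration) auto
  also have "- (real t / 6)\<^sup>2 / (16 * (2 * \<rho>)\<^sup>2 * real (card S))
      = - (real t)\<^sup>2 / (2304 * \<rho>\<^sup>2 * real (card S))"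
    by (simp add: power_divide power_mult_distrib)
  finally show ?thesis .
qed

lemma g_le: "g p \<le> real t"
proof -
  have "(\<Sum>q\<in>B. min (real (X p q)) (real t)) \<le> (\<Sum>q\<in>B. real t)"
    by (intro sum_mono) auto
  then show ?thesis using card_B_pos by (simp add: g_def field_simps)
qed

end

text \<open>Cells that are heavy for \<open>B\<close> must carry a constant fraction of the agreements, because the
  number of agreements on light cells concentrates below \<open>t\<close>.\<close>
lemma ex_cyl_product_ge:
  assumes S: "finite S" and n: "card S \<ge> 4" and c: "crossing S t A B" and t: "t \<ge> 1"
    and ne: "A \<noteq> {}" "B \<noteq> {}" and A: "fact (card S) \<le> real (card A) * real (card S) ^ (3 * t)"
  shows "\<exists>i\<in>S. \<exists>j\<in>S. real (card (cyl A i j)) * real (card (cyl B i j))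
    \<ge> eta (card S) t * real (card A) * real (card B)"
proof (rule ccontr)
  assume neg: "\<not> ?thesis"
  define n where "n = real (card S)"
  define \<rho> where "\<rho> = sqrt (real t / (13824 * n * ln n))"
  have n4: "n \<ge> 4" using n by (simp add: n_def)
  then have ln0: "ln n > 0" by simp
  have rho: "\<rho> > 0" using t n4 ln0 by (simp add: \<rho>_def)
  have rho2: "\<rho>\<^sup>2 = real t / (13824 * n * ln n)" using n4 ln0 by (simp add: \<rho>_def)
  have sub: "A \<subseteq> {p. p permutes S}" "B \<subseteq> {p. p permutes S}" using c by (auto simp: crossing_def)
  have fin: "finite A" "finite B" using crossing_finite[OF S c] .
  have pos: "real (card A) > 0" "real (card B) > 0" using fin ne by (simp_all add: card_gt_0_iff)
  interpret light_agreement S B t \<rho>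
    using S sub ne rho by unfold_locales
  define E where "E = {p \<in> A. g p \<ge> 5 / 6 * real t}"
  have "real (card E) \<le> real (card {p. p permutes S \<and> g p \<ge> 5 / 6 * real t})"
    using finite_permutations[OF S] sub by (intro of_nat_mono card_mono) (auto simp: E_def)
  also have "\<dots> \<le> fact (card S) * exp (- (real t)\<^sup>2 / (2304 * \<rho>\<^sup>2 * real (card S)))"
    using n by (intro card_g_large_le) simp
  also have "- (real t)\<^sup>2 / (2304 * \<rho>\<^sup>2 * real (card S)) = - (6 * real t * ln n)"
  proof -
    have "2304 * \<rho>\<^sup>2 * real (card S) = real t / (6 * ln n)"
      using n4 ln0 unfolding rho2 n_def[symmetric] by (simp add: field_simps)
    then show ?thesis
      unfolding \<open>2304 * \<rho>\<^sup>2 * real (card S) = _\<close> using t ln0 by (simp add: power2_eq_square)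
  qed
  also have "exp (- (6 * real t * ln n)) = 1 / n ^ (6 * t)"
  proof -
    have "exp (real (6 * t) * ln n) = n ^ (6 * t)"
      using n4 by (subst exp_of_nat_mult) simp
    then show ?thesis by (simp add: exp_minus inverse_eq_divide)
  qed
  also have "fact (card S) * (1 / n ^ (6 * t)) \<le> real (card A) * n ^ (3 * t) * (1 / n ^ (6 * t))"
    using A n4 by (intro mult_right_mono) (auto simp: n_def)
  also have "\<dots> = real (card A) / n ^ (3 * t)"
    using n4 by (simp add: power_mult[symmetric] power_add[symmetric] field_simps flip: mult_2)
  \<comment> \<open>The value 42 gives \<open>5 / 6 + 1 / 42 = 6 / 7\<close> in the bound for the
    sum of \<open>g\<close> over \<open>A\<close>.\<close>
  also have "\<dots> \<le> real (card A) / 42"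
  proof (intro divide_left_mono)
    have "(42::real) \<le> 4 ^ 3" by simp
    also have "\<dots> \<le> 4 ^ (3 * t)" using t by (intro power_increasing) auto
    also have "\<dots> \<le> n ^ (3 * t)" using n4 by (intro power_mono) auto
    finally show "42 \<le> n ^ (3 * t)" .
  qed (use n4 in auto)
  finally have E: "real (card E) \<le> real (card A) / 42" .
  have "(\<Sum>p\<in>A. g p) \<le> (\<Sum>p\<in>A. 5 / 6 * real t + (if p \<in> E then real t else 0))"
  proof (intro sum_mono)
    fix p assume "p \<in> A"
    then show "g p \<le> 5 / 6 * real t + (if p \<in> E then real t else 0)"
      using g_le[of p] by (auto simp: E_def)
  qed
  also have "\<dots> = 5 / 6 * real t * real (card A) + real t * real (card E)"
  proof -
    have "A \<inter> E = E" by (auto simp: E_def)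
    then show ?thesis using fin by (simp add: sum.distrib sum.If_cases)
  qed
  also have "\<dots> \<le> 5 / 6 * real t * real (card A) + real t * (real (card A) / 42)"
    using E by (intro add_left_mono mult_left_mono) auto
  finally have gA: "(\<Sum>p\<in>A. g p) \<le> 6 / 7 * real t * real (card A)" by (simp add: algebra_simps)
  define W where "W = {(i, j). i \<in> S \<and> j \<in> S \<and> \<not> light i j}"
  have WS: "W \<subseteq> S \<times> S" by (auto simp: W_def)
  have fW: "finite W" using WS S finite_subset by blast
  have H: "real t - min (real (X p q)) (real t) \<le> real (card {i \<in> S. p i = q i \<and> (i, p i) \<in> W})"
    if pq: "p \<in> A" "q \<in> B" for p q
  proof -
    have p: "p permutes S" using pq sub by auto
    have "agree S p q = {i \<in> S. p i = q i \<and> light i (p i)} \<union> {i \<in> S. p i = q i \<and> (i, p i) \<in> W}"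
      using permutes_in_image[OF p] by (auto simp: agree_def W_def)
    then have "card (agree S p q) \<le> X p q + card {i \<in> S. p i = q i \<and> (i, p i) \<in> W}"
      by (simp add: X_def card_Un_le)
    moreover have "t \<le> card (agree S p q)" using c pq by (auto simp: crossing_def)
    ultimately have "real t \<le> real (X p q) + real (card {i \<in> S. p i = q i \<and> (i, p i) \<in> W})"
      by linarith
    then show ?thesis by (simp add: min_def)
  qed
  \<comment> \<open>Each pair has at least \<open>t\<close> agreements, and capped light agreements
    average at most \<open>6 / 7 * t\<close>, so heavy cells carry at least \<open>t / 7\<close> on
    average.\<close>
  have "real (card A) * real (card B) * real t / 7
      \<le> real t * real (card A) * real (card B) - (\<Sum>p\<in>A. g p) * real (card B)"
    using mult_right_mono[OF gA, of "real (card B)"] by (simp add: algebra_simps)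
  also have "(\<Sum>p\<in>A. g p) * real (card B) = (\<Sum>p\<in>A. \<Sum>q\<in>B. min (real (X p q)) (real t))"
    using pos by (simp add: g_def sum_divide_distrib[symmetric])
  also have "real t * real (card A) * real (card B) - \<dots> = (\<Sum>p\<in>A. \<Sum>q\<in>B. real t - min (real (X p q)) (real t))"
    by (simp add: sum_subtractf)
  also have "\<dots> \<le> (\<Sum>p\<in>A. \<Sum>q\<in>B. real (card {i \<in> S. p i = q i \<and> (i, p i) \<in> W}))"
    by (intro sum_mono H)
  also have "\<dots> = (\<Sum>(i, j)\<in>W. real (card (cyl A i j)) * real (card (cyl B i j)))"
    by (rule sum_card_agree_on[OF S fin sub(1) WS])
  finally have lower: "real (card A) * real (card B) * real t / 7
      \<le> (\<Sum>(i, j)\<in>W. real (card (cyl A i j)) * real (card (cyl B i j)))" .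
  moreover have "real (card A) * real (card B) * real t / 7 > 0" using pos t by simp
  ultimately have "W \<noteq> {}" by force
  then have "(\<Sum>(i, j)\<in>W. real (card (cyl A i j)) * real (card (cyl B i j)))
      < (\<Sum>(i, j)\<in>W. eta (card S) t * real (card A) * real (card B))"
    using neg fW by (intro sum_strict_mono) (auto simp: W_def not_le)
  also have "\<dots> = real (card W) * (eta (card S) t * real (card A) * real (card B))"
    by simp
  \<comment> \<open>A heavy cell holds at least \<open>\<rho> * card B\<close> of the total
    \<open>n * card B\<close> over all cells, so there are at most \<open>n / \<rho>\<close> heavy
    cells.\<close>
  also have "\<dots> \<le> n / \<rho> * (eta (card S) t * real (card A) * real (card B))"
  proof (intro mult_right_mono)
    have "real (card W) * (\<rho> * real (card B)) = (\<Sum>(i, j)\<in>W. \<rho> * real (card B))" by simp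
    also have "\<dots> \<le> (\<Sum>(i, j)\<in>W. real (card (cyl B i j)))"
      by (intro sum_mono) (auto simp: W_def light_def)
    also have "\<dots> \<le> (\<Sum>(i, j)\<in>S \<times> S. real (card (cyl B i j)))"
      using WS S by (intro sum_mono2) auto
    also have "\<dots> = (\<Sum>i\<in>S. \<Sum>j\<in>S. real (card (cyl B i j)))"
      by (simp add: sum.cartesian_product)
    also have "\<dots> = n * real (card B)"
      using sum_card_cyl[OF S fin(2) sub(2)] by (simp add: n_def flip: of_nat_sum)
    finally have "real (card W) * \<rho> \<le> n" using pos by simp
    then show "real (card W) \<le> n / \<rho>" using rho by (simp add: field_simps)
  qed (use pos n4 rho in \<open>simp add: eta_def n_def[symmetric] \<rho>_def[symmetric]\<close>)
  also have "n / \<rho> * (eta (card S) t * real (card A) * real (card B)) = real (card A) * real (card B) * real t / 7"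
    using n4 rho by (simp add: eta_def n_def[symmetric] \<rho>_def[symmetric])
  finally show False using lower by simp
qed

subsection \<open>Restriction to a cell\<close>

lemma transpose_comp_permutes_Diff:
  assumes "p permutes S" "i \<in> S" "p i = j"
  shows "transpose i j \<circ> p permutes S - {i}"
  using permutes_insert_lemma[of p i "S - {i}"] assms by (simp add: insert_absorb)

lemma card_image_transpose: "card ((\<circ>) (transpose i j) ` A) = card A"
proof (intro card_image inj_onI)
  fix p q assume "transpose i j \<circ> p = transpose i j \<circ> q"
  then have "transpose i j \<circ> (transpose i j \<circ> p) = transpose i j \<circ> (transpose i j \<circ> q)" by simp
  then show "p = q" by (simp add: o_assoc)
qed

lemma agree_transpose_comp: "agree S (transpose i j \<circ> p) (transpose i j \<circ> q) = agree S p q"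
  by (auto simp: agree_def transpose_def split: if_splits)

lemma agree_Diff: "agree (S - T) p q = agree S p q - T"
  by (auto simp: agree_def)

text \<open>Composing both families with \<open>transpose i j\<close> on the value side preserves
  all agreements and makes \<open>i\<close> a fixed point. Deleting \<open>i\<close> then costs at
  most one agreement.\<close>

lemma crossing_cyl:
  assumes c: "crossing S t A B" and i: "i \<in> S"
  shows "crossing (S - {i}) (t - 1) ((\<circ>) (transpose i j) ` cyl A i j) ((\<circ>) (transpose i j) ` cyl B i j)"
  unfolding crossing_def
proof (intro conjI ballI)
  show "(\<circ>) (transpose i j) ` cyl A i j \<subseteq> {p. p permutes S - {i}}"
    "(\<circ>) (transpose i j) ` cyl B i j \<subseteq> {p. p permutes S - {i}}"
    using c i by (auto simp: crossing_def cyl_def intro!: transpose_comp_permutes_Diff)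
next
  fix p' q' assume "p' \<in> (\<circ>) (transpose i j) ` cyl A i j" "q' \<in> (\<circ>) (transpose i j) ` cyl B i j"
  then obtain p q where p: "p \<in> A" "p' = transpose i j \<circ> p" and q: "q \<in> B" "q' = transpose i j \<circ> q"
    by (auto simp: cyl_def)
  have "t \<le> card (agree S p q)" using c p q by (simp add: crossing_def)
  also have "\<dots> \<le> card (agree S p q - {i}) + 1"
    using diff_card_le_card_Diff[of "{i}" "agree S p q"] by simp
  finally show "t - 1 \<le> card (agree (S - {i}) p' q')"
    by (simp add: p q agree_transpose_comp agree_Diff)
qed

text \<open>Swapping the values \<open>j\<close> and \<open>j'\<close> in \<open>cyl A i j'\<close> destroys no agreement with \<open>cyl B i j\<close>: in the
  rows other than \<open>i\<close> the former never takes the value \<open>j'\<close> and the latter never takes \<open>j\<close>.\<close>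
lemma crossing_cyl_distinct:
  assumes S: "finite S" and c: "crossing S t A B" and i: "i \<in> S" and j: "j \<in> S" "j' \<in> S" "j \<noteq> j'"
  shows "crossing (S - {i}) t ((\<circ>) (transpose i j) ` (\<circ>) (transpose j j') ` cyl A i j')
    ((\<circ>) (transpose i j) ` cyl B i j)"
  unfolding crossing_def
proof (intro conjI ballI)
  show "(\<circ>) (transpose i j) ` (\<circ>) (transpose j j') ` cyl A i j' \<subseteq> {p. p permutes S - {i}}"
  proof
    fix r assume "r \<in> (\<circ>) (transpose i j) ` (\<circ>) (transpose j j') ` cyl A i j'"
    then obtain p where p: "p \<in> A" "p i = j'" "r = transpose i j \<circ> (transpose j j' \<circ> p)"
      by (auto simp: cyl_def)
    have "transpose j j' \<circ> p permutes S"
      using p c j by (intro permutes_compose permutes_swap_id) (auto simp: crossing_def)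
    then show "r \<in> {p. p permutes S - {i}}"
      using p i by (auto intro!: transpose_comp_permutes_Diff)
  qed
  show "(\<circ>) (transpose i j) ` cyl B i j \<subseteq> {p. p permutes S - {i}}"
    using c i by (auto simp: crossing_def cyl_def intro!: transpose_comp_permutes_Diff)
next
  fix p' q' assume "p' \<in> (\<circ>) (transpose i j) ` (\<circ>) (transpose j j') ` cyl A i j'"
    and "q' \<in> (\<circ>) (transpose i j) ` cyl B i j"
  then obtain p q where p: "p \<in> A" "p i = j'" "p' = transpose i j \<circ> (transpose j j' \<circ> p)"
    and q: "q \<in> B" "q i = j" "q' = transpose i j \<circ> q"
    by (auto simp: cyl_def)
  have perm: "p permutes S" "q permutes S" using c p q by (auto simp: crossing_def)
  have "agree S p q \<subseteq> agree S (transpose j j' \<circ> p) q - {i}"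
  proof
    fix k assume k: "k \<in> agree S p q"
    then have pk: "p k = q k" "k \<in> S" by (auto simp: agree_def)
    have ki: "k \<noteq> i" using pk p(2) q(2) j(3) by auto
    then have "p k \<noteq> j'" "q k \<noteq> j"
      using p(2) q(2) perm[THEN permutes_inj] by (auto dest: injD)
    then show "k \<in> agree S (transpose j j' \<circ> p) q - {i}"
      using pk ki by (simp add: agree_def)
  qed
  then have "card (agree S p q) \<le> card (agree S (transpose j j' \<circ> p) q - {i})"
    using S by (intro card_mono) (auto simp: agree_def)
  moreover have "t \<le> card (agree S p q)" using c p q by (simp add: crossing_def)
  ultimately show "t \<le> card (agree (S - {i}) p' q')"
    by (simp add: p(3) q(3) agree_transpose_comp agree_Diff)
qed

text \<open>The factor \<open>v\<close> compares the product with that of a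
  \<open>t\<close>-umvirate taken twice, so \<open>v = 1\<close> is the sharp bound. Weaker values
  serve as intermediate induction hypotheses.\<close>

definition bounded :: "nat \<Rightarrow> nat \<Rightarrow> real \<Rightarrow> bool" where
  "bounded n t v \<longleftrightarrow> (\<forall>(S :: nat set) A B. finite S \<longrightarrow> card S = n \<longrightarrow> crossing S t A B \<longrightarrow>
     real (card A) * real (card B) \<le> v * (fact (n - t))\<^sup>2)"

text \<open>The part of \<open>A\<close> off the cell splits by the value \<open>j'\<close> at
  \<open>i\<close>. Each piece still crosses \<open>cyl B i j\<close> in \<open>t\<close> points in
  degree \<open>card S - 1\<close>, and passing from \<open>fact (n - 1 - t)\<close> to
  \<open>fact (n - t)\<close> gains \<open>n - t\<close> in each factor.\<close>

lemma card_off_cyl_le: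
  fixes S :: "nat set"
  assumes S: "finite S" and t: "t < card S" and c: "crossing S t A B" and i: "i \<in> S" and j: "j \<in> S"
    and v: "bounded (card S - 1) t v" "v \<ge> 0"
  shows "(real (card A) - real (card (cyl A i j))) * real (card (cyl B i j))
    \<le> v * (real (card S) / (real (card S - t))\<^sup>2) * (fact (card S - t))\<^sup>2"
proof -
  let ?n = "card S" and ?b = "real (card (cyl B i j))"
  have cSi: "card (S - {i}) = ?n - 1" using S i by simp
  have sub: "A \<subseteq> {p. p permutes S}" using c by (auto simp: crossing_def)
  have one: "real (card (cyl A i j')) * ?b \<le> v * (fact (?n - 1 - t))\<^sup>2" if "j' \<in> S - {j}" for j'
  proof -
    have "crossing (S - {i}) t ((\<circ>) (transpose i j) ` (\<circ>) (transpose j j') ` cyl A i j')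
        ((\<circ>) (transpose i j) ` cyl B i j)"
      using that by (intro crossing_cyl_distinct[OF S c i j]) auto
    from v(1)[unfolded bounded_def, rule_format, OF _ cSi this] show ?thesis
      using S by (simp add: card_image_transpose)
  qed
  have "card A = card (cyl A i j) + (\<Sum>j'\<in>S - {j}. card (cyl A i j'))"
    using sum_card_cyl[OF S crossing_finite(1)[OF S c] sub i] S j by (simp add: sum.remove)
  then have "(real (card A) - real (card (cyl A i j))) * ?b = (\<Sum>j'\<in>S - {j}. real (card (cyl A i j')) * ?b)"
    by (simp add: sum_distrib_right)
  also have "\<dots> \<le> (\<Sum>j'\<in>S - {j}. v * (fact (?n - 1 - t))\<^sup>2)"
    by (intro sum_mono one)
  also have "\<dots> = real (card (S - {j})) * (v * (fact (?n - 1 - t))\<^sup>2)" by simp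
  also have "\<dots> \<le> real ?n * (v * (fact (?n - 1 - t))\<^sup>2)"
    using S v(2) by (intro mult_right_mono) (auto intro: card_mono)
  also have "\<dots> = v * (real ?n / (real (?n - t))\<^sup>2) * (fact (?n - t))\<^sup>2"
  proof -
    have "?n - t = Suc (?n - 1 - t)" using t by simp
    then have "fact (?n - t) = real (?n - t) * fact (?n - 1 - t)" by (metis fact_Suc)
    then show ?thesis using t by (simp add: power_mult_distrib)
  qed
  finally show ?thesis .
qed

lemma card_off_cyl_le':
  fixes S :: "nat set"
  assumes S: "finite S" and t: "t < card S" and c: "crossing S t A B" and i: "i \<in> S" and j: "j \<in> S"
    and v: "bounded (card S - 1) t v" "v \<ge> 0"
  shows "real (card (cyl A i j)) * (real (card B) - real (card (cyl B i j)))
    \<le> v * (real (card S) / (real (card S - t))\<^sup>2) * (fact (card S - t))\<^sup>2"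
  using card_off_cyl_le[OF S t crossing_sym[OF c] i j v] by (simp only: mult.commute)

lemma fact_le_pow_mult_fact:
  assumes "t \<le> n"
  shows "(fact n :: real) \<le> real n ^ t * fact (n - t)"
proof -
  have "real (fact n div fact (n - t)) \<le> real (n ^ t)"
    using fact_div_fact_le_pow[OF assms] by (simp only: of_nat_le_iff)
  moreover have "real (fact n div fact (n - t)) = fact n / fact (n - t)"
    by (simp add: real_of_nat_div fact_dvd)
  ultimately show ?thesis by (simp add: field_simps)
qed

text \<open>Since \<open>card B \<le> fact n\<close>, a large product forces \<open>A\<close> to be
  large: \<open>fact n \<le> n ^ t * fact (n - t)\<close> is used twice, and the factor 2 is
  absorbed in a third \<open>n ^ t\<close>.\<close>

lemma crossing_card_lower:
  fixes S :: "nat set"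
  assumes S: "finite S" and n: "card S \<ge> 2" and t: "1 \<le> t" and c: "crossing S t A B"
    and Q: "real (card A) * real (card B) \<ge> 1 / 2 * (fact (card S - t))\<^sup>2"
  shows "fact (card S) \<le> real (card A) * real (card S) ^ (3 * t)"
proof -
  let ?n = "card S"
  let ?N = "fact (?n - t) :: real"
  have "A \<noteq> {}" "B \<noteq> {}" using Q by auto
  then have tn: "t \<le> ?n" using crossing_le_card[OF S c] by blast
  have "fact ?n \<le> real ?n ^ t * ?N" using tn by (rule fact_le_pow_mult_fact)
  then have "(fact ?n)\<^sup>2 \<le> (real ?n ^ t * ?N)\<^sup>2" by (intro power_mono) auto
  also have "\<dots> = real ?n ^ (2 * t) * ?N\<^sup>2"
    by (simp add: power_mult_distrib power_even_eq)
  also have "\<dots> \<le> real ?n ^ (2 * t) * (2 * (real (card A) * real (card B)))"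
    using Q by (intro mult_left_mono) auto
  also have "\<dots> \<le> real ?n ^ (2 * t) * (real ?n ^ t * (real (card A) * fact ?n))"
  proof (intro mult_left_mono mult_mono)
    have "(2::real) \<le> real ?n ^ 1" using n by simp
    also have "\<dots> \<le> real ?n ^ t" using n t by (intro power_increasing) auto
    finally show "2 \<le> real ?n ^ t" .
    have "card B \<le> card {p. p permutes S}"
      using c finite_permutations[OF S] by (intro card_mono) (auto simp: crossing_def)
    then show "real (card B) \<le> fact ?n"
      unfolding card_permutations[OF refl S] by (metis of_nat_fact of_nat_le_iff)
  qed auto
  also have "\<dots> = real (card A) * real ?n ^ (3 * t) * fact ?n"
  proof -
    have "3 * t = 2 * t + t" by simp
    then show ?thesis by (simp only: power_add mult_ac)
  qed
  finally have "fact ?n * fact ?n \<le> real (card A) * real ?n ^ (3 * t) * fact ?n"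
    by (simp only: power2_eq_square)
  then show ?thesis by (rule mult_right_le_imp_le) simp
qed

text \<open>Split the product into four by membership in the cell. The mixed terms
  \<open>a' * b\<close> and \<open>a * b'\<close> are at most \<open>Y\<close>; the term with both
  off the cell is controlled through \<open>(a' * b') * (a * b) = (a' * b) * (a * b')\<close>, where
  heaviness bounds \<open>a * b\<close> from below.\<close>

lemma crossing_step:
  fixes S :: "nat set"
  assumes S: "finite S" and n: "card S \<ge> 4" and t: "1 \<le> t" "t < card S" and c: "crossing S t A B"
    and Q: "real (card A) * real (card B) \<ge> 1 / 2 * (fact (card S - t))\<^sup>2"
    and v: "bounded (card S - 1) t v" "v \<ge> 0"
    and Y: "Y = v * (real (card S) / (real (card S - t))\<^sup>2) * (fact (card S - t))\<^sup>2"
  shows "\<exists>i\<in>S. \<exists>j\<in>S. real (card A) * real (card B) \<le> real (card (cyl A i j)) * real (card (cyl B i j))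
    + 2 * Y + Y\<^sup>2 / (eta (card S) t * (real (card A) * real (card B)))"
proof -
  have ne: "A \<noteq> {}" "B \<noteq> {}" using Q by auto
  have pos: "real (card A) * real (card B) > 0"
    using crossing_finite[OF S c] ne by (simp add: card_gt_0_iff)
  have eta: "eta (card S) t > 0"
  proof -
    have "ln (real (card S)) > 0" using n by simp
    then show ?thesis using n t by (simp add: eta_def)
  qed
  obtain i j where ij: "i \<in> S" "j \<in> S" and e: "real (card (cyl A i j)) * real (card (cyl B i j))
      \<ge> eta (card S) t * real (card A) * real (card B)"
    using ex_cyl_product_ge[OF S n c t(1) ne crossing_card_lower[OF S _ t(1) c Q]] n by auto
  define a b a' b' where "a = real (card (cyl A i j))" and "b = real (card (cyl B i j))"
    and "a' = real (card A) - a" and "b' = real (card B) - b"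
  have ab': "a' * b \<le> Y" "a * b' \<le> Y"
    using card_off_cyl_le[OF S t(2) c ij v] card_off_cyl_le'[OF S t(2) c ij v]
    unfolding Y a'_def b'_def a_def b_def by simp_all
  have nn: "a \<ge> 0" "b \<ge> 0" "a' \<ge> 0" "b' \<ge> 0"
    using card_mono[OF crossing_finite(1)[OF S c], of "cyl A i j"]
      card_mono[OF crossing_finite(2)[OF S c], of "cyl B i j"]
    by (auto simp: a_def b_def a'_def b'_def cyl_def)
  define E where "E = eta (card S) t * (real (card A) * real (card B))"
  have E: "E > 0" using pos eta by (simp add: E_def)
  have "(a' * b') * E \<le> (a' * b') * (a * b)"
    using e nn by (intro mult_left_mono) (auto simp: E_def a_def b_def mult_ac)
  also have "\<dots> = (a' * b) * (a * b')" by simp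
  also have "\<dots> \<le> Y * Y" using ab' nn by (intro mult_mono) (auto intro: order.trans[OF _ ab'(1)])
  finally have "a' * b' \<le> Y\<^sup>2 / E" using E by (simp add: field_simps power2_eq_square)
  moreover have "real (card A) * real (card B) = a * b + a' * b + a * b' + a' * b'"
    by (simp add: a'_def b'_def algebra_simps)
  ultimately have "real (card A) * real (card B) \<le> a * b + 2 * Y + Y\<^sup>2 / E"
    using ab' by linarith
  then show ?thesis using ij unfolding a_def b_def E_def by blast
qed

lemma eta_eq:
  assumes "n \<ge> 2"
  shows "eta n t = real t * sqrt (real t) / (7 * real n * sqrt (13824 * real n * ln (real n)))"
  using assms by (simp add: eta_def real_sqrt_divide)

text \<open>The left side is at most \<open>(4 / n)\<^sup>2\<close>, whereas
  \<open>eta n t / (t * sqrt t)\<close> has order \<open>1 / (n * sqrt (n * ln n))\<close> with no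
  \<open>t\<close> left in it, so the estimate is uniform in \<open>t\<close>. The factor
  \<open>1 / (t * sqrt t)\<close> is kept because it is summable.\<close>

lemma eta_loss_le:
  assumes "e > 0"
  shows "\<exists>n0. \<forall>n\<ge>n0. \<forall>t\<ge>1. 2 * t \<le> n \<longrightarrow>
    (real n / (real (n - t))\<^sup>2)\<^sup>2 \<le> e / (real t * sqrt (real t)) * eta n t"
proof -
  \<comment> \<open>\<open>112 = 16 * 7\<close>: the square of 4 from
    \<open>n - t \<ge> n / 2\<close>, and the 7 in \<open>eta\<close>.\<close>
  have "(\<lambda>n::nat. 112 * sqrt (13824 * real n * ln (real n)) / real n) \<longlonglongrightarrow> 0"
    by real_asymp
  then have "eventually (\<lambda>n::nat. 112 * sqrt (13824 * real n * ln (real n)) / real n < e) sequentially"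
    using assms by (rule order_tendstoD)
  then obtain n1 where n1: "\<And>n. n \<ge> n1 \<Longrightarrow> 112 * sqrt (13824 * real n * ln (real n)) / real n < e"
    by (auto simp: eventually_sequentially)
  have "(real n / (real (n - t))\<^sup>2)\<^sup>2 \<le> e / (real t * sqrt (real t)) * eta n t"
    if n: "n \<ge> max n1 2" and t: "t \<ge> 1" "2 * t \<le> n" for n t
  proof -
    define R where "R = sqrt (13824 * real n * ln (real n))"
    have "ln (real n) > 0" using n by simp
    then have R: "R > 0" using n by (simp add: R_def)
    have "real n / (real (n - t))\<^sup>2 \<le> real n / (real n / 2)\<^sup>2"
      using n t by (intro divide_left_mono power_mono mult_pos_pos) (auto simp: of_nat_diff)
    also have "\<dots> = 4 / real n" using n by (simp add: power2_eq_square field_simps)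
    finally have "(real n / (real (n - t))\<^sup>2)\<^sup>2 \<le> (4 / real n)\<^sup>2"
      by (intro power_mono) auto
    also have "\<dots> = 112 * R / real n * (1 / (7 * real n * R))"
      using n R by (simp add: power2_eq_square field_simps)
    also have "\<dots> \<le> e * (1 / (7 * real n * R))"
      using n1[of n] n R by (intro mult_right_mono) (auto simp: R_def)
    also have "\<dots> = e / (real t * sqrt (real t)) * eta n t"
      using t n by (simp add: eta_eq R_def)
    finally show ?thesis .
  qed
  then show ?thesis by blast
qed

subsection \<open>Descent to an umvirate\<close>

text \<open>Prescribing the values by a permutation \<open>q\<close> makes the targets distinct
  automatically.\<close>

definition umv :: "'a set \<Rightarrow> 'a set \<Rightarrow> ('a \<Rightarrow> 'a) \<Rightarrow> ('a \<Rightarrow> 'a) set" where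
  "umv S I q = {p. p permutes S \<and> (\<forall>i\<in>I. p i = q i)}"

lemma card_umv:
  "finite S \<Longrightarrow> I \<subseteq> S \<Longrightarrow> q permutes S \<Longrightarrow> card (umv S I q) = fact (card S - card I)"
  by (simp add: umv_def card_permutes_agreeing)

lemma finite_umv: "finite S \<Longrightarrow> finite (umv S I q)"
  unfolding umv_def by (rule finite_subset[OF _ finite_permutations[of S]]) auto

text \<open>As \<open>q\<close> fixes \<open>i\<close>, the map
  \<open>transpose i j \<circ> q\<close> sends \<open>i\<close> to \<open>j\<close>. An umvirate
  found after restriction thus lifts to one on \<open>S\<close> with the cell \<open>(i, j)\<close>
  added.\<close>

lemma umv_transpose:
  assumes i: "i \<in> S" and j: "j \<in> S" and q: "q permutes S - {i}" and I: "I \<subseteq> S - {i}"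
  shows "(\<circ>) (transpose i j) ` cyl A i j \<inter> umv (S - {i}) I q
    \<subseteq> (\<circ>) (transpose i j) ` (A \<inter> umv S (insert i I) (transpose i j \<circ> q))"
proof
  fix r assume r: "r \<in> (\<circ>) (transpose i j) ` cyl A i j \<inter> umv (S - {i}) I q"
  then obtain p where p: "p \<in> A" "p i = j" "r = transpose i j \<circ> p" by (auto simp: cyl_def)
  have pr: "p = transpose i j \<circ> r" using p(3) by (simp add: o_assoc)
  have "r permutes S" using r by (auto simp: umv_def intro: permutes_subset)
  then have "p permutes S"
    unfolding pr using i j by (intro permutes_compose permutes_swap_id)
  moreover have "p k = (transpose i j \<circ> q) k" if "k \<in> insert i I" for k
    using that
  proof
    assume "k = i"
    then show ?thesis using p(2) permutes_not_in[OF q, of i] by simp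
  next
    assume "k \<in> I"
    then have "r k = q k" using r by (simp add: umv_def)
    then show ?thesis by (simp add: pr)
  qed
  ultimately show "r \<in> (\<circ>) (transpose i j) ` (A \<inter> umv S (insert i I) (transpose i j \<circ> q))"
    using p by (auto simp: umv_def)
qed

text \<open>If \<open>p \<in> A\<close> leaves the umvirate at \<open>k \<in> I\<close>, it has at
  most \<open>t - 1\<close> agreements inside \<open>I\<close> with any member of \<open>B\<close>
  in the umvirate, so it must agree with that member outside \<open>I\<close>. At most two thirds of
  the umvirate can do so.\<close>

lemma subset_umv:
  assumes S: "finite S" and c: "crossing S t A B" and I: "I \<subseteq> S" "card I = t" and q: "q permutes S"
    and m: "card S - t \<ge> 3" and B: "3 * real (card (B \<inter> umv S I q)) > 2 * fact (card S - t)"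
  shows "A \<subseteq> umv S I q"
proof
  fix p assume p: "p \<in> A"
  have perm: "p permutes S" using p c by (auto simp: crossing_def)
  show "p \<in> umv S I q"
  proof (rule ccontr)
    assume "p \<notin> umv S I q"
    then obtain k where k: "k \<in> I" "p k \<noteq> q k" using perm by (auto simp: umv_def)
    have fI: "finite I" using S I finite_subset by blast
    have "B \<inter> umv S I q \<subseteq> {r. r permutes S \<and> (\<forall>i\<in>I. r i = q i) \<and> (\<exists>i\<in>S - I. r i = p i)}"
    proof
      fix r assume r: "r \<in> B \<inter> umv S I q"
      have "\<not> agree S p r \<subseteq> I - {k}"
      proof
        assume "agree S p r \<subseteq> I - {k}"
        then have "card (agree S p r) \<le> card (I - {k})" using fI by (intro card_mono) auto
        also have "\<dots> < t" using k fI I(2) by (metis card_Diff1_less)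
        finally show False using c p r by (force simp: crossing_def)
      qed
      then obtain i where i: "i \<in> S" "p i = r i" "i \<notin> I - {k}" by (auto simp: agree_def)
      then have "i \<noteq> k" using k r by (auto simp: umv_def)
      then have "i \<in> S - I" "r i = p i" using i by auto
      then have "\<exists>i\<in>S - I. r i = p i" by blast
      then show "r \<in> {r. r permutes S \<and> (\<forall>i\<in>I. r i = q i) \<and> (\<exists>i\<in>S - I. r i = p i)}"
        using r by (auto simp: umv_def)
    qed
    then have "card (B \<inter> umv S I q)
        \<le> card {r. r permutes S \<and> (\<forall>i\<in>I. r i = q i) \<and> (\<exists>i\<in>S - I. r i = p i)}"
      using S by (intro card_mono finite_subset[OF _ finite_permutations[OF S]]) auto
    then show False
      using card_umvirate_agreeing_le[OF S q perm I(1)] m I(2) B by simp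
  qed
qed

lemma bounded_mono:
  assumes "bounded n t v" "v \<le> w"
  shows "bounded n t w"
  unfolding bounded_def
proof (intro allI impI)
  fix S :: "nat set" and A B assume "finite S" "card S = n" "crossing S t A B"
  then have "real (card A) * real (card B) \<le> v * (fact (n - t))\<^sup>2"
    using assms(1) unfolding bounded_def by blast
  also have "\<dots> \<le> w * (fact (n - t))\<^sup>2" using assms(2) by (intro mult_right_mono) auto
  finally show "real (card A) * real (card B) \<le> w * (fact (n - t))\<^sup>2" .
qed

lemma bounded_0: "bounded n 0 1"
  unfolding bounded_def
proof (intro allI impI)
  fix S :: "nat set" and A B assume S: "finite S" "card S = n" and c: "crossing S 0 A B"
  have *: "real (card A) \<le> fact n" if "A \<subseteq> {p. p permutes S}" for A
    using card_mono[OF finite_permutations[OF S(1)] that]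
    unfolding card_permutations[OF S(2,1)] by (metis of_nat_fact of_nat_le_iff)
  have "real (card A) * real (card B) \<le> fact n * fact n"
    using c by (intro mult_mono *) (auto simp: crossing_def)
  then show "real (card A) * real (card B) \<le> 1 * (fact (n - 0))\<^sup>2"
    by (simp add: power2_eq_square)
qed

lemma bounded_crude: "bounded n t (4 ^ n)"
  unfolding bounded_def
proof (intro allI impI)
  fix S :: "nat set" and A B assume S: "finite S" "card S = n" and c: "crossing S t A B"
  show "real (card A) * real (card B) \<le> 4 ^ n * (fact (n - t))\<^sup>2"
  proof (cases "A = {} \<or> B = {}")
    case False
    have *: "real (card A) \<le> 2 ^ n * fact (n - t)" if "crossing S t A B" "B \<noteq> {}" for A B
    proof -
      have "real (card A) \<le> real (2 ^ n * fact (n - t))"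
        using crossing_card_le[OF S(1) that] S(2) by (simp only: of_nat_le_iff)
      then show ?thesis by simp
    qed
    have "real (card A) * real (card B) \<le> (2 ^ n * fact (n - t)) * (2 ^ n * fact (n - t))"
      using c crossing_sym[OF c] False by (intro mult_mono *) auto
    also have "\<dots> = 4 ^ n * (fact (n - t))\<^sup>2"
      by (simp add: power2_eq_square flip: power_mult_distrib)
    finally show ?thesis .
  qed auto
qed

text \<open>Telescoping against \<open>2 / sqrt s\<close>, as in comparison with the
  integral.\<close>

lemma sum_inverse_three_halves_le: "(\<Sum>s=1..t. 1 / (real s * sqrt (real s))) \<le> 3"
proof -
  have "(\<Sum>s=1..Suc t. 1 / (real s * sqrt (real s))) \<le> 3 - 2 / sqrt (real (Suc t))" for t
  proof (induction t)
    case 0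
    show ?case by simp
  next
    case (Suc t)
    define x y where "x = sqrt (real (Suc t))" and "y = sqrt (real (Suc (Suc t)))"
    have x: "x > 0" "x \<le> y" and y: "y > 0" "y * y = real (Suc (Suc t))" "y\<^sup>2 = x\<^sup>2 + 1"
      by (auto simp: x_def y_def)
    have "x * (y + x) \<le> y * (y + y)" using x by (intro mult_mono) auto
    then have "1 / (y * y * y) \<le> 2 / (x * y * (y + x))"
      using x y by (simp add: divide_simps mult_ac)
    also have "\<dots> = 2 * ((y + x) * (y - x)) / (x * y * (y + x))"
      using y(3) by (simp add: power2_eq_square algebra_simps)
    also have "\<dots> = 2 / x - 2 / y" using x y by (simp add: divide_simps)
    finally have "1 / (y * y * y) \<le> 2 / x - 2 / y" .
    moreover have "(\<Sum>s=1..Suc (Suc t). 1 / (real s * sqrt (real s)))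
        = (\<Sum>s=1..Suc t. 1 / (real s * sqrt (real s))) + 1 / (y * y * y)"
      unfolding y(2) by (simp add: y_def)
    ultimately show ?case using Suc.IH unfolding x_def y_def by linarith
  qed
  moreover have "(\<Sum>s=1..t. 1 / (real s * sqrt (real s))) \<le> (\<Sum>s=1..Suc t. 1 / (real s * sqrt (real s)))"
    by simp
  moreover have "2 / sqrt (real (Suc t)) \<ge> 0" by simp
  ultimately show ?thesis by (smt (verit))
qed

section \<open>Losses along the descent\<close>

locale small_loss =
  fixes m0 :: nat
  assumes m0: "m0 \<ge> 64"
    and loss: "\<And>n t. n \<ge> m0 \<Longrightarrow> t \<ge> 1 \<Longrightarrow> 2 * t \<le> n \<Longrightarrow>
      (real n / (real (n - t))\<^sup>2)\<^sup>2 \<le> 1 / 4000 / (real t * sqrt (real t)) * eta n t"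
begin

lemma step:
  fixes S :: "nat set"
  assumes S: "finite S" "card S = n" and n: "n \<ge> m0" and t: "1 \<le> t" "2 * t \<le> n" and c: "crossing S t A B"
    and Q: "real (card A) * real (card B) \<ge> 1 / 2 * (fact (n - t))\<^sup>2"
    and v: "bounded (n - 1) t v" "v \<ge> 0"
  shows "\<exists>i\<in>S. \<exists>j\<in>S. real (card A) * real (card B) \<le> real (card (cyl A i j)) * real (card (cyl B i j))
    + 8 * v / real n * (fact (n - t))\<^sup>2
    + v\<^sup>2 * (1 / 4000 / (real t * sqrt (real t))) * ((fact (n - t))\<^sup>2)\<^sup>2 / (real (card A) * real (card B))"
proof -
  define N where "N = (fact (n - t) :: real)\<^sup>2"
  define th where "th = real n / (real (n - t))\<^sup>2"
  define Q' where "Q' = real (card A) * real (card B)"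
  define Y where "Y = v * th * N"
  have n64: "n \<ge> 64" using n m0 by simp
  have N: "N > 0" by (simp add: N_def)
  have Q': "Q' > 0" using Q N unfolding N_def Q'_def by linarith
  have eta: "eta n t > 0"
    using n64 t by (simp add: eta_eq)
  obtain i j where ij: "i \<in> S" "j \<in> S"
    and le: "Q' \<le> real (card (cyl A i j)) * real (card (cyl B i j)) + 2 * Y + Y\<^sup>2 / (eta n t * Q')"
    using crossing_step[OF S(1) _ t(1) _ c _ _ v(2), of Y] S n64 t Q v(1)
    unfolding Y_def th_def N_def Q'_def by auto
  have "th \<le> 4 / real n"
  proof -
    have "th \<le> real n / (real n / 2)\<^sup>2"
      unfolding th_def using n64 t by (intro divide_left_mono power_mono mult_pos_pos) (auto simp: of_nat_diff)
    also have "\<dots> = 4 / real n" using n64 by (simp add: power2_eq_square field_simps)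
    finally show ?thesis .
  qed
  then have "2 * Y \<le> 2 * (v * (4 / real n) * N)"
    unfolding Y_def using v(2) N by (intro mult_left_mono mult_right_mono) auto
  then have 1: "2 * Y \<le> 8 * v / real n * N" by simp
  have "Y\<^sup>2 / (eta n t * Q') = v\<^sup>2 * th\<^sup>2 * N\<^sup>2 / (eta n t * Q')"
    by (simp add: Y_def power_mult_distrib)
  also have "\<dots> \<le> v\<^sup>2 * (1 / 4000 / (real t * sqrt (real t)) * eta n t) * N\<^sup>2 / (eta n t * Q')"
    using loss[OF n t] eta Q' unfolding th_def
    by (intro divide_right_mono mult_right_mono mult_left_mono) auto
  also have "\<dots> = v\<^sup>2 * (1 / 4000 / (real t * sqrt (real t))) * N\<^sup>2 / Q'"
    using eta by simp
  finally show ?thesis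
    using ij le 1 unfolding N_def Q'_def by (smt (verit))
qed

text \<open>\<open>step\<close> with \<open>v = 4\<close> loses
  \<open>8 * 4 / n \<le> 32 / m\<close>, and \<open>4\<^sup>2 / 4000\<close> times
  \<open>N\<^sup>2 / Q \<le> 2 * N\<close>, in which \<open>N = (fact m)\<^sup>2\<close> and
  \<open>Q\<close> is the product of the cardinalities.\<close>

definition total_loss :: "nat \<Rightarrow> nat \<Rightarrow> real" where
  "total_loss m t = 32 * real t / real m + 32 / 4000 * (\<Sum>s=1..t. 1 / (real s * sqrt (real s)))"

lemma total_loss_le: "m \<ge> m0 \<Longrightarrow> 2000 * t \<le> m \<Longrightarrow> total_loss m t \<le> 1 / 20"
proof -
  assume m: "m \<ge> m0" "2000 * t \<le> m"
  have "real (2000 * t) \<le> real m" using m(2) by (simp only: of_nat_le_iff)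
  then have "32 * real t / real m \<le> 32 / 2000" using m m0 by (simp add: divide_simps)
  then show ?thesis
    using sum_inverse_three_halves_le[of t] unfolding total_loss_def by simp
qed

lemma total_loss_nonneg: "total_loss m t \<ge> 0"
  unfolding total_loss_def by (intro add_nonneg_nonneg mult_nonneg_nonneg sum_nonneg) auto

text \<open>Restricting to one heavy cell after another keeps \<open>card S - t\<close>, here \<open>m\<close>, constant.\<close>
lemma descent:
  fixes S :: "nat set"
  assumes "finite S" "card S = m + t" "m \<ge> m0" "t \<le> m" "crossing S t A B"
    and "\<And>s. 1 \<le> s \<Longrightarrow> s \<le> t \<Longrightarrow> bounded (m + s - 1) s 4"
    and "real (card A) * real (card B) \<ge> (1 / 2 + total_loss m t) * (fact m)\<^sup>2"
  shows "\<exists>I q. I \<subseteq> S \<and> card I = t \<and> q permutes S \<and>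
    real (card A) * real (card B) \<le>
      real (card (A \<inter> umv S I q)) * real (card (B \<inter> umv S I q)) + total_loss m t * (fact m)\<^sup>2"
  using assms
proof (induction t arbitrary: S A B)
  case 0
  have "A \<inter> umv S {} id = A" "B \<inter> umv S {} id = B"
    using 0 by (auto simp: umv_def crossing_def)
  then have "real (card A) * real (card B) \<le>
      real (card (A \<inter> umv S {} id)) * real (card (B \<inter> umv S {} id)) + total_loss m 0 * (fact m)\<^sup>2"
    by (simp only:) (simp add: total_loss_def)
  then show ?case using permutes_id by (metis card.empty empty_subsetI)
next
  case (Suc t)
  define N where "N = (fact m :: real)\<^sup>2"
  define Q where "Q = real (card A) * real (card B)"
  define n where "n = m + Suc t"
  define h where "h = 1 / (real (Suc t) * sqrt (real (Suc t)))"
  have N: "N > 0" by (simp add: N_def)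
  have nt: "n - Suc t = m" by (simp add: n_def)
  have tl: "total_loss m (Suc t) = total_loss m t + 32 / real m + 32 / 4000 * h"
  proof -
    have "(\<Sum>s=1..Suc t. 1 / (real s * sqrt (real s))) = (\<Sum>s=1..t. 1 / (real s * sqrt (real s))) + h"
      by (simp add: h_def)
    then show ?thesis unfolding total_loss_def by (simp only:) (simp add: add_divide_distrib distrib_left)
  qed
  \<comment> \<open>The excess over one half pays for the remaining steps, so the product stays at
    least \<open>1 / 2 * N\<close> throughout, as \<open>step\<close> demands.\<close>
  have Qlow: "Q \<ge> (1 / 2 + total_loss m (Suc t)) * N" using Suc.prems unfolding Q_def N_def by simp
  moreover have "(1 / 2 + total_loss m (Suc t)) * N \<ge> 1 / 2 * N"
    using N total_loss_nonneg by (intro mult_right_mono) auto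
  ultimately have Q: "Q \<ge> 1 / 2 * N" by linarith
  have S: "finite S" "card S = n" and c: "crossing S (Suc t) A B"
    using Suc.prems by (auto simp: n_def)
  have bd: "bounded (n - 1) (Suc t) 4" using Suc.prems(6)[of "Suc t"] by (simp add: n_def)
  obtain i j where i: "i \<in> S" and j: "j \<in> S"
    and le: "Q \<le> real (card (cyl A i j)) * real (card (cyl B i j)) + 8 * 4 / real n * N
      + 4\<^sup>2 * (1 / 4000 * h) * N\<^sup>2 / Q"
    using step[OF S _ _ _ c _ bd] Suc.prems(3,4) Q nt unfolding Q_def N_def h_def n_def by auto
  have "N\<^sup>2 / Q \<le> 2 * N"
    using Q N by (simp add: power2_eq_square field_simps)
  moreover have h: "h \<ge> 0" by (simp add: h_def)
  ultimately have "(4\<^sup>2 * (1 / 4000 * h)) * (N\<^sup>2 / Q) \<le> (4\<^sup>2 * (1 / 4000 * h)) * (2 * N)"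
    by (intro mult_left_mono) auto
  moreover have "8 * 4 / real n \<le> 32 / real m"
    using Suc.prems(3) m0 by (simp add: n_def divide_simps)
  then have "8 * 4 / real n * N \<le> 32 / real m * N"
    using N by (intro mult_right_mono) auto
  ultimately have le': "Q \<le> real (card (cyl A i j)) * real (card (cyl B i j)) + (32 / real m + 32 / 4000 * h) * N"
    using le by (simp add: algebra_simps)
  let ?A = "(\<circ>) (transpose i j) ` cyl A i j" and ?B = "(\<circ>) (transpose i j) ` cyl B i j"
  have cAB: "card ?A = card (cyl A i j)" "card ?B = card (cyl B i j)"
    by (simp_all only: card_image_transpose)
  have "\<exists>I q. I \<subseteq> S - {i} \<and> card I = t \<and> q permutes S - {i} \<and>
      real (card ?A) * real (card ?B) \<le>
      real (card (?A \<inter> umv (S - {i}) I q)) * real (card (?B \<inter> umv (S - {i}) I q)) + total_loss m t * (fact m)\<^sup>2"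
  proof (rule Suc.IH)
    show "finite (S - {i})" "card (S - {i}) = m + t" using S i by (auto simp: n_def)
    show "crossing (S - {i}) t ?A ?B" using crossing_cyl[OF c i, of j] by simp
    show "bounded (m + s - 1) s 4" if "1 \<le> s" "s \<le> t" for s using Suc.prems(6) that by simp
    show "real (card ?A) * real (card ?B) \<ge> (1 / 2 + total_loss m t) * (fact m)\<^sup>2"
      unfolding cAB using Qlow le' tl unfolding N_def by (simp add: algebra_simps)
  qed (use Suc.prems in auto)
  then obtain I q where I: "I \<subseteq> S - {i}" "card I = t" and q: "q permutes S - {i}"
    and fin: "real (card ?A) * real (card ?B) \<le>
      real (card (?A \<inter> umv (S - {i}) I q)) * real (card (?B \<inter> umv (S - {i}) I q)) + total_loss m t * N"
    unfolding N_def by blast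
  define U where "U = umv S (insert i I) (transpose i j \<circ> q)"
  have fAB: "finite A" "finite B" using crossing_finite[OF S(1) c] .
  have "real (card (?A \<inter> umv (S - {i}) I q)) * real (card (?B \<inter> umv (S - {i}) I q))
      \<le> real (card (A \<inter> U)) * real (card (B \<inter> U))"
    using surj_card_le[OF _ umv_transpose[OF i j q I(1)], of A]
      surj_card_le[OF _ umv_transpose[OF i j q I(1)], of B] fAB
    unfolding U_def by (intro mult_mono) auto
  then have "Q \<le> real (card (A \<inter> U)) * real (card (B \<inter> U)) + total_loss m (Suc t) * N"
    using fin le' unfolding cAB tl by (simp add: algebra_simps)
  moreover have "insert i I \<subseteq> S" "card (insert i I) = Suc t"
    using I i S finite_subset[OF I(1)] by (auto simp: card_insert_if)
  moreover have "transpose i j \<circ> q permutes S"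
    using q i j by (intro permutes_compose permutes_swap_id permutes_subset[OF q]) auto
  ultimately show ?case unfolding Q_def N_def U_def by blast
qed

section \<open>Stability and the sharp bound from slack 4 in smaller degrees\<close>

context
  fixes m t :: nat
  assumes m: "m \<ge> m0" "2000 * t \<le> m"
    and bd: "\<And>s. 1 \<le> s \<Longrightarrow> s \<le> t \<Longrightarrow> bounded (m + s - 1) s 4"
begin

text \<open>The threshold \<open>14 / 25\<close> fits between \<open>1 / 2 + 1 / 20\<close>, which
  \<open>descent\<close> requires, and \<open>(3 / 4)\<^sup>2 = 9 / 16\<close>, which a single
  family provides.\<close>

lemma ex_umv:
  fixes S :: "nat set"
  assumes S: "finite S" "card S = m + t" and c: "crossing S t A B"
    and Q: "real (card A) * real (card B) \<ge> 14 / 25 * (fact m)\<^sup>2"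
  shows "\<exists>I q. I \<subseteq> S \<and> card I = t \<and> q permutes S \<and> real (card A) * real (card B) \<le>
    real (card (A \<inter> umv S I q)) * real (card (B \<inter> umv S I q)) + 1 / 20 * (fact m)\<^sup>2"
proof -
  have L: "total_loss m t \<le> 1 / 20" using total_loss_le m by blast
  have "(1 / 2 + total_loss m t) * (fact m)\<^sup>2 \<le> 14 / 25 * (fact m)\<^sup>2"
    using L by (intro mult_right_mono) auto
  then have "real (card A) * real (card B) \<ge> (1 / 2 + total_loss m t) * (fact m)\<^sup>2"
    using Q by linarith
  then obtain I q where I: "I \<subseteq> S" "card I = t" "q permutes S"
    and le: "real (card A) * real (card B) \<le>
      real (card (A \<inter> umv S I q)) * real (card (B \<inter> umv S I q)) + total_loss m t * (fact m)\<^sup>2"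
    using descent[OF S m(1) _ c bd] m by auto
  have "total_loss m t * (fact m)\<^sup>2 \<le> 1 / 20 * (fact m)\<^sup>2"
    using L by (intro mult_right_mono) auto
  then show ?thesis using I le by (smt (verit))
qed

lemma card_Int_umv_le:
  fixes S :: "nat set"
  assumes "finite S" "card S = m + t" "I \<subseteq> S" "card I = t" "q permutes S"
  shows "real (card (A \<inter> umv S I q)) \<le> fact m"
proof -
  have "card (A \<inter> umv S I q) \<le> card (umv S I q)"
    using finite_umv[OF assms(1)] by (intro card_mono) auto
  also have "\<dots> = fact m" using card_umv[OF assms(1,3,5)] assms(2,4) by simp
  finally show ?thesis by (metis of_nat_fact of_nat_le_iff)
qed

text \<open>After the loss of \<open>1 / 20\<close>, \<open>7 / 10\<close> of the product is left.
  Both traces have at most \<open>fact m\<close> elements, so each has at least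
  \<open>7 / 10 * fact m\<close>, more than the two thirds in \<open>subset_umv\<close>.\<close>

lemma both_subset_umv:
  fixes S :: "nat set"
  assumes S: "finite S" "card S = m + t" and c: "crossing S t A B"
    and Q: "real (card A) * real (card B) \<ge> 3 / 4 * (fact m)\<^sup>2"
  shows "\<exists>I q. I \<subseteq> S \<and> card I = t \<and> q permutes S \<and> A \<subseteq> umv S I q \<and> B \<subseteq> umv S I q"
proof -
  let ?F = "fact m :: real"
  have F: "?F > 0" by simp
  have "14 / 25 * ?F\<^sup>2 \<le> 3 / 4 * ?F\<^sup>2" by simp
  then have Q56: "14 / 25 * ?F\<^sup>2 \<le> real (card A) * real (card B)" using Q by linarith
  obtain I q where I: "I \<subseteq> S" "card I = t" "q permutes S"
    and le: "real (card A) * real (card B) \<le>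
      real (card (A \<inter> umv S I q)) * real (card (B \<inter> umv S I q)) + 1 / 20 * ?F\<^sup>2"
    using ex_umv[OF S c Q56] by blast
  define a b where "a = real (card (A \<inter> umv S I q))" and "b = real (card (B \<inter> umv S I q))"
  have ab: "a \<le> ?F" "b \<le> ?F" "a \<ge> 0" "b \<ge> 0"
    using card_Int_umv_le[OF S I] by (auto simp: a_def b_def)
  have "7 / 10 * ?F * ?F \<le> a * b"
    using le Q unfolding a_def b_def by (simp add: power2_eq_square)
  moreover have "a * b \<le> a * ?F" "a * b \<le> ?F * b" using ab by (intro mult_mono; simp)+
  ultimately have "(7 / 10 * ?F) * ?F \<le> a * ?F" "(7 / 10 * ?F) * ?F \<le> b * ?F"
    unfolding mult.commute[of b] by linarith+
  then have "7 / 10 * ?F \<le> a" "7 / 10 * ?F \<le> b"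
    using mult_right_le_imp_le[OF _ F] by blast+
  then have "3 * a > 2 * ?F" "3 * b > 2 * ?F" using F by linarith+
  moreover have "card S - t = m" "m \<ge> 3" using S(2) m m0 by auto
  ultimately have "A \<subseteq> umv S I q" "B \<subseteq> umv S I q"
    using subset_umv[OF S(1) c I] subset_umv[OF S(1) crossing_sym[OF c] I]
    unfolding a_def b_def by simp_all
  then show ?thesis using I by blast
qed

lemma self_subset_umv:
  fixes S :: "nat set"
  assumes S: "finite S" "card S = m + t" and c: "crossing S t A A"
    and Q: "real (card A) \<ge> 3 / 4 * fact m"
  shows "\<exists>I q. I \<subseteq> S \<and> card I = t \<and> q permutes S \<and> A \<subseteq> umv S I q"
proof -
  let ?F = "fact m :: real"
  have F: "?F > 0" by simp
  have "(3 / 4 * ?F) * (3 / 4 * ?F) \<le> real (card A) * real (card A)"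
    using Q by (intro mult_mono) auto
  then have Q2: "9 / 16 * ?F\<^sup>2 \<le> real (card A) * real (card A)" by (simp add: power2_eq_square)
  have F2: "?F\<^sup>2 > 0" by simp
  have Q56: "14 / 25 * ?F\<^sup>2 \<le> real (card A) * real (card A)" using Q2 F2 by linarith
  obtain I q where I: "I \<subseteq> S" "card I = t" "q permutes S"
    and le: "real (card A) * real (card A) \<le>
      real (card (A \<inter> umv S I q)) * real (card (A \<inter> umv S I q)) + 1 / 20 * ?F\<^sup>2"
    using ex_umv[OF S c Q56] by blast
  define a where "a = real (card (A \<inter> umv S I q))"
  \<comment> \<open>\<open>9 / 16 - 1 / 20 = 41 / 80\<close> exceeds \<open>51 / 100\<close>, which
    in turn exceeds \<open>(7 / 10)\<^sup>2\<close>.\<close>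
  have "51 / 100 * ?F\<^sup>2 \<le> a\<^sup>2"
    using le Q2 F2 unfolding a_def[symmetric] power2_eq_square[of a] by linarith
  moreover have "(7 / 10 * ?F)\<^sup>2 = 49 / 100 * ?F\<^sup>2" by (simp add: power2_eq_square)
  ultimately have "(7 / 10 * ?F)\<^sup>2 \<le> a\<^sup>2" using F2 by linarith
  then have "7 / 10 * ?F \<le> a" by (rule power2_le_imp_le) (simp add: a_def)
  then have "3 * a > 2 * ?F" using F by linarith
  moreover have "card S - t = m" "m \<ge> 3" using S(2) m m0 by auto
  ultimately have "A \<subseteq> umv S I q"
    using subset_umv[OF S(1) c I] unfolding a_def by simp
  then show ?thesis using I by blast
qed

text \<open>A product above the bound would put both families into one umvirate, which has only
  \<open>fact m\<close> elements.\<close>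

lemma bounded_1: "bounded (m + t) t 1"
  unfolding bounded_def
proof (intro allI impI)
  fix S :: "nat set" and A B assume S: "finite S" "card S = m + t" and c: "crossing S t A B"
  show "real (card A) * real (card B) \<le> 1 * (fact (m + t - t))\<^sup>2"
  proof (rule ccontr)
    assume neg: "\<not> ?thesis"
    then have "real (card A) * real (card B) > (fact m)\<^sup>2" by simp
    moreover have "3 / 4 * (fact m)\<^sup>2 \<le> (fact m :: real)\<^sup>2" by simp
    ultimately have "real (card A) * real (card B) \<ge> 3 / 4 * (fact m)\<^sup>2" by linarith
    then obtain I q where I: "I \<subseteq> S" "card I = t" "q permutes S" and sub: "A \<subseteq> umv S I q" "B \<subseteq> umv S I q"
      using both_subset_umv[OF S c] by blast
    have "A \<inter> umv S I q = A" "B \<inter> umv S I q = B" using sub by auto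
    then have "real (card A) \<le> fact m" "real (card B) \<le> fact m"
      using card_Int_umv_le[OF S I, of A] card_Int_umv_le[OF S I, of B] by simp_all
    then have "real (card A) * real (card B) \<le> fact m * fact m" by (intro mult_mono) auto
    then show False using neg by (simp add: power2_eq_square)
  qed
qed

end

section \<open>Induction on the degree\<close>

definition slack :: "nat \<Rightarrow> nat \<Rightarrow> real" where
  "slack n t = 2 ^ (1 + ((3 * m0 + 6003) * t - n))"

text \<open>Truncated subtraction keeps \<open>slack\<close> at 2 for all \<open>n\<close> above the
  line \<open>(3 * m0 + 6003) * t\<close>. The pairs \<open>n - t + s - 1\<close>, \<open>s\<close>
  met in the descent lie at most one unit below that line, so their slack is at most 4.\<close>

lemma bounded_1_of_slack:
  assumes t: "t \<ge> 1" and n: "(3 * m0 + 6003) * t \<le> n"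
    and IH: "\<And>n' s. n' < n \<Longrightarrow> bounded n' s (slack n' s)"
  shows "n - t \<ge> m0" "2000 * t \<le> n - t"
    and "\<And>s. 1 \<le> s \<Longrightarrow> s \<le> t \<Longrightarrow> bounded (n - t + s - 1) s 4"
proof -
  let ?c = "3 * m0 + 6003"
  have tt: "m0 \<le> m0 * t" using t by simp
  have ct: "?c * t = 3 * (m0 * t) + 6003 * t" by (simp add: algebra_simps)
  show "n - t \<ge> m0" "2000 * t \<le> n - t" using n tt unfolding ct by linarith+
  fix s assume s: "1 \<le> s" "s \<le> t"
  have "bounded (n - t + s - 1) s (slack (n - t + s - 1) s)"
    using n s t unfolding ct by (intro IH) linarith
  moreover have "slack (n - t + s - 1) s \<le> 4"
  proof -
    have "(?c - 1) * s \<le> (?c - 1) * t" using s by simp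
    then have "?c * s + t \<le> ?c * t + s" by (simp add: algebra_simps)
    then have "?c * s - (n - t + s - 1) \<le> 1" using n s by linarith
    then have "slack (n - t + s - 1) s \<le> 2 ^ 2"
      unfolding slack_def by (intro power_increasing) auto
    then show ?thesis by simp
  qed
  ultimately show "bounded (n - t + s - 1) s 4" by (rule bounded_mono)
qed

text \<open>A step lowers \<open>n\<close> alone and so may leave the range \<open>n \<ge> c * t\<close>. The bound is therefore extended
  below this range with a factor \<open>2\<close> per unit, which dominates the crude \<open>4 ^ n\<close> once \<open>3 * n \<le> c * t\<close>.\<close>
lemma bounded_slack: "bounded n t (slack n t)"
proof (induction n arbitrary: t rule: less_induct)
  case (less n)
  let ?c = "3 * m0 + 6003"
  define \<Phi> where "\<Phi> = slack n t"
  have \<Phi>2: "\<Phi> \<ge> 2"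
    unfolding \<Phi>_def slack_def using one_le_power[of "2::real"] by simp
  consider "t = 0" | "3 * n \<le> ?c * t" | "t \<ge> 1" "3 * n > ?c * t" by linarith
  then show ?case
  proof cases
    case 1
    then show ?thesis using bounded_mono[OF bounded_0] \<Phi>2 unfolding \<Phi>_def by simp
  next
    case 2
    have "(4::real) ^ n = 2 ^ (2 * n)" by (simp add: power_mult)
    also have "\<dots> \<le> slack n t" unfolding slack_def using 2 by (intro power_increasing) auto
    finally show ?thesis using bounded_mono[OF bounded_crude] by blast
  next
    case 3
    have ct: "?c * t = 3 * (m0 * t) + 6003 * t" by (simp add: algebra_simps)
    have "m0 \<le> m0 * t" using 3 by simp
    \<comment> \<open>A third of \<open>?c\<close> is \<open>m0 + 2001\<close>, so
      \<open>3 * n > ?c * t\<close> still puts \<open>n\<close> above both \<open>m0\<close> and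
      \<open>2 * t\<close>.\<close>
    then have n: "n \<ge> m0" "2 * t \<le> n" "n \<ge> 1" "n \<ge> 64"
      using 3 m0 unfolding ct by linarith+
    have "slack (n - 1) t \<le> 2 ^ Suc (1 + (?c * t - n))"
      unfolding slack_def by (intro power_increasing) auto
    then have "slack (n - 1) t \<le> 2 * \<Phi>" by (simp add: \<Phi>_def slack_def)
    then have bd: "bounded (n - 1) t (2 * \<Phi>)" using less.IH[of "n - 1" t] n bounded_mono by simp
    \<comment> \<open>Below the line, lowering \<open>t\<close> along with \<open>n\<close> shortens
      the distance to it and at least halves the slack. On or above it the slack stops at 2, and the
      sharp bound in degree \<open>n - 1\<close> supplies \<open>1 \<le> \<Phi> / 2\<close>
      instead.\<close>
    have bd0: "bounded (n - 1) (t - 1) (\<Phi> / 2)"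
    proof (cases "t = 1 \<or> ?c * (t - 1) \<le> n - 1")
      case True
      have "bounded (n - 1) (t - 1) 1"
      proof (cases "t = 1")
        case True
        then show ?thesis using bounded_0 by simp
      next
        case False
        have t1: "t - 1 \<ge> 1" "?c * (t - 1) \<le> n - 1" using True False 3 by auto
        have IH: "bounded n' s (slack n' s)" if "n' < n - 1" for n' s
          using less.IH that by simp
        have "n - 1 - (t - 1) + (t - 1) = n - 1" using n by simp
        then show ?thesis
          using bounded_1[OF bounded_1_of_slack[OF t1 IH]] by simp
      qed
      then show ?thesis using bounded_mono \<Phi>2 by auto
    next
      case False
      have "?c * t = ?c * (t - 1) + ?c" using 3(1) by (cases t) simp_all
      then have "Suc (1 + (?c * (t - 1) - (n - 1))) \<le> 1 + (?c * t - n)" using False by linarith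
      then have "(2::real) ^ Suc (1 + (?c * (t - 1) - (n - 1))) \<le> \<Phi>"
        unfolding \<Phi>_def slack_def by (intro power_increasing) auto
      then have "slack (n - 1) (t - 1) \<le> \<Phi> / 2" by (simp add: slack_def)
      then show ?thesis using less.IH[of "n - 1" "t - 1"] n bounded_mono by simp
    qed
    show ?thesis
      unfolding bounded_def \<Phi>_def[symmetric]
    proof (intro allI impI)
      fix S :: "nat set" and A B assume S: "finite S" "card S = n" and c: "crossing S t A B"
      define N where "N = (fact (n - t) :: real)\<^sup>2"
      define Q where "Q = real (card A) * real (card B)"
      have N: "N > 0" by (simp add: N_def)
      have "Q \<le> \<Phi> * N"
      proof (rule ccontr)
        assume "\<not> Q \<le> \<Phi> * N"
        then have QP: "Q > \<Phi> * N" by simp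
        have "1 / 2 * N \<le> \<Phi> * N" using \<Phi>2 N by (intro mult_right_mono) auto
        then have Qlow: "Q \<ge> 1 / 2 * N" using QP by linarith
        then have Qpos: "Q > 0" using N by linarith
        define h where "h = 1 / 4000 / (real t * sqrt (real t))"
        obtain i j where i: "i \<in> S" and j: "j \<in> S"
          and le: "Q \<le> real (card (cyl A i j)) * real (card (cyl B i j)) + 8 * (2 * \<Phi>) / real n * N
            + (2 * \<Phi>)\<^sup>2 * h * N\<^sup>2 / Q"
          using step[OF S n(1) 3(1) n(2) c _ bd] Qlow \<Phi>2 unfolding Q_def N_def h_def by auto
        have cS: "card (S - {i}) = n - 1" using S i by simp
        have "n - 1 - (t - 1) = n - t" using 3 by simp
        then have 1: "real (card (cyl A i j)) * real (card (cyl B i j)) \<le> \<Phi> / 2 * N"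
          using bd0[unfolded bounded_def, rule_format, OF _ cS crossing_cyl[OF c i, of j]] S(1)
          unfolding card_image_transpose N_def by simp
        have "8 * (2 * \<Phi>) / real n * N \<le> 8 * (2 * \<Phi>) / 64 * N"
          using n(4) \<Phi>2 N by (intro mult_right_mono divide_left_mono) auto
        then have 2: "8 * (2 * \<Phi>) / real n * N \<le> \<Phi> / 4 * N" by simp
        have "1 * 1 \<le> real t * sqrt (real t)" using 3 by (intro mult_mono) auto
        then have "h \<le> 1 / 4000 / 1" unfolding h_def by (intro divide_left_mono) auto
        then have h: "h \<le> 1 / 32" by simp
        have h0: "h \<ge> 0" by (simp add: h_def)
        have "(2 * \<Phi>)\<^sup>2 * h * N\<^sup>2 / Q \<le> (2 * \<Phi>)\<^sup>2 * h * N\<^sup>2 / (\<Phi> * N)"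
          using QP Qpos \<Phi>2 N h0 by (intro divide_left_mono mult_pos_pos) auto
        also have "\<dots> = 4 * h * (\<Phi> * N)" using \<Phi>2 N by (simp add: power2_eq_square)
        also have "\<dots> \<le> 4 * (1 / 32) * (\<Phi> * N)" using h \<Phi>2 N by (intro mult_right_mono mult_left_mono) auto
        finally have "(2 * \<Phi>)\<^sup>2 * h * N\<^sup>2 / Q \<le> 1 / 8 * (\<Phi> * N)" by simp
        moreover have "\<Phi> / 2 * N = 1 / 2 * (\<Phi> * N)" "\<Phi> / 4 * N = 1 / 4 * (\<Phi> * N)" by simp_all
        \<comment> \<open>The cell contributes \<open>1 / 2\<close>, the mixed terms
          \<open>16 / 64\<close>, the last term \<open>4 / 32\<close>; the sum stays below
          1.\<close>
        ultimately have "Q \<le> 7 / 8 * (\<Phi> * N)" using le 1 2 by linarith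
        moreover have "\<Phi> * N > 0" using \<Phi>2 N by simp
        ultimately show False using QP by linarith
      qed
      then show "real (card A) * real (card B) \<le> \<Phi> * (fact (n - t))\<^sup>2"
        unfolding Q_def N_def .
    qed
  qed
qed

end

section \<open>Transfer to the symmetric group on \<open>{1..n}\<close>\<close>

lemma cross_intersecting_crossing:
  assumes "A \<subseteq> symm_group n" "B \<subseteq> symm_group n" "cross_intersecting n t A B"
  shows "crossing {1..n} t A B"
  unfolding crossing_def
proof (intro conjI ballI)
  show "A \<subseteq> {p. p permutes {1..n}}" "B \<subseteq> {p. p permutes {1..n}}"
    using assms by (auto simp: symm_group_def)
next
  fix p q assume "p \<in> A" "q \<in> B"
  then obtain i where i: "distinct_points n t i" "\<forall>l\<in>{1..t}. p (i l) = q (i l)"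
    using assms(3) by (meson cross_intersecting_def)
  then have "card (i ` {1..t}) = t" by (simp add: distinct_points_def card_image)
  moreover have "i ` {1..t} \<subseteq> agree {1..n} p q"
    using i by (auto simp: distinct_points_def agree_def)
  ultimately show "t \<le> card (agree {1..n} p q)"
    by (metis agree_def card_mono finite_Collect_conjI finite_atLeastAtMost mem_Collect_eq finite_subset subsetI)
qed

text \<open>Take \<open>i\<close> to enumerate \<open>I\<close> and
  \<open>j = q \<circ> i\<close>.\<close>

lemma umv_umvirate:
  assumes I: "I \<subseteq> {1..n}" "card I = t" and q: "q permutes {1..n}"
  shows "\<exists>i j. distinct_points n t i \<and> distinct_points n t j \<and> umv {1..n} I q \<subseteq> umvirate n t i j"
proof -
  obtain i where i: "bij_betw i {1..t} I"
    using ex_bij_betw_nat_finite_1[of I] I finite_subset by blast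
  have "distinct_points n t i" using i I by (auto simp: distinct_points_def bij_betw_def)
  moreover have "distinct_points n t (q \<circ> i)"
  proof -
    have "inj_on (q \<circ> i) {1..t}"
      using i permutes_inj_on[OF q] by (auto simp: bij_betw_def intro: comp_inj_on)
    moreover have "(q \<circ> i) ` {1..t} = q ` I"
      using i by (auto simp: bij_betw_def)
    then have "(q \<circ> i) ` {1..t} \<subseteq> {1..n}"
      using image_mono[OF I(1), of q] permutes_image[OF q] by simp
    ultimately show ?thesis by (simp add: distinct_points_def)
  qed
  moreover have "umv {1..n} I q \<subseteq> umvirate n t i (q \<circ> i)"
    using i by (auto simp: umv_def umvirate_def symm_group_def bij_betw_def)
  ultimately show ?thesis by blast
qed

theorem theorem1:
  shows "\<exists>c0::real. c0 > 0 \<and>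
    (\<forall>(t::nat) (n::nat) (A::(nat \<Rightarrow> nat) set) (B::(nat \<Rightarrow> nat) set).
       t \<ge> 1 \<longrightarrow> real n \<ge> c0 * real t \<longrightarrow>
       A \<subseteq> symm_group n \<longrightarrow> B \<subseteq> symm_group n \<longrightarrow> cross_intersecting n t A B \<longrightarrow>
         card A * card B \<le> (fact (n - t))\<^sup>2 \<and>
         (real (card A * card B) \<ge> 0.75 * (fact (n - t))\<^sup>2 \<longrightarrow>
            (\<exists>i j. distinct_points n t i \<and> distinct_points n t j \<and>
                   A \<subseteq> umvirate n t i j \<and> B \<subseteq> umvirate n t i j)) \<and>
         (A = B \<and> real (card A) \<ge> 0.75 * fact (n - t) \<longrightarrow>
            (\<exists>i j. distinct_points n t i \<and> distinct_points n t j \<and>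
                   A \<subseteq> umvirate n t i j)))"
proof -
  obtain n0 where n0: "\<forall>n\<ge>n0. \<forall>t\<ge>1. 2 * t \<le> n \<longrightarrow>
      (real n / (real (n - t))\<^sup>2)\<^sup>2 \<le> 1 / 4000 / (real t * sqrt (real t)) * eta n t"
    using eta_loss_le[of "1 / 4000"] by auto
  define M where "M = max n0 64"
  interpret small_loss M
    using n0 by unfold_locales (auto simp: M_def)
  show ?thesis
  proof (intro exI[of _ "real (3 * M + 6003)"] conjI allI impI)
    show "real (3 * M + 6003) > 0" by simp
  next
    fix t n :: nat and A B :: "(nat \<Rightarrow> nat) set"
    assume t: "t \<ge> 1" and n: "real n \<ge> real (3 * M + 6003) * real t"
      and AB: "A \<subseteq> symm_group n" "B \<subseteq> symm_group n" "cross_intersecting n t A B"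
    have n': "(3 * M + 6003) * t \<le> n" using n by (simp only: of_nat_mult[symmetric] of_nat_le_iff)
    note m = bounded_1_of_slack[OF t n' bounded_slack]
    have c: "crossing {1..n} t A B" using cross_intersecting_crossing[OF AB] .
    have "t \<le> (3 * M + 6003) * t" by simp
    then have "t \<le> n" using n' by linarith
    then have S: "finite {1..n}" "card {1..n} = n - t + t" by simp_all
    have "bounded (n - t + t) t 1" using bounded_1[OF m] .
    have "real (card A) * real (card B) \<le> (fact (n - t))\<^sup>2"
      using \<open>bounded (n - t + t) t 1\<close>[unfolded bounded_def, rule_format, OF S c] by simp
    then have "real (card A * card B) \<le> real ((fact (n - t))\<^sup>2)"
      by (simp only: of_nat_mult of_nat_power of_nat_fact)
    then show "card A * card B \<le> (fact (n - t))\<^sup>2" by (simp only: of_nat_le_iff)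
    {
      assume "real (card A * card B) \<ge> 0.75 * (fact (n - t))\<^sup>2"
      then have "real (card A) * real (card B) \<ge> 3 / 4 * (fact (n - t))\<^sup>2" by simp
      then obtain I q where I: "I \<subseteq> {1..n}" "card I = t" "q permutes {1..n}"
        and sub: "A \<subseteq> umv {1..n} I q" "B \<subseteq> umv {1..n} I q"
        using both_subset_umv[OF m S c] by blast
      show "\<exists>i j. distinct_points n t i \<and> distinct_points n t j \<and>
          A \<subseteq> umvirate n t i j \<and> B \<subseteq> umvirate n t i j"
        using umv_umvirate[OF I] sub by (meson subset_trans)
    }
    {
      assume eq: "A = B \<and> real (card A) \<ge> 0.75 * fact (n - t)"
      have "real (card A) \<ge> 3 / 4 * fact (n - t)" using conjunct2[OF eq] by simp
      moreover have "crossing {1..n} t A A" using c eq by simp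
      ultimately obtain I q where I: "I \<subseteq> {1..n}" "card I = t" "q permutes {1..n}"
        and sub: "A \<subseteq> umv {1..n} I q"
        using self_subset_umv[OF m S] by blast
      show "\<exists>i j. distinct_points n t i \<and> distinct_points n t j \<and> A \<subseteq> umvirate n t i j"
        using umv_umvirate[OF I] sub by (meson subset_trans)
    }
  qed
qed

end
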